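(* Let $\mathcal{D}[t]\subset\mathcal{H}\subset\mathcal{D}^\times[t^\times]$ be a rigged Hilbert space with $\mathcal{D}[t]$ complete and reflexive, and let $\{\xi_n\}$ be a sequence of elements of $\mathcal{D}$. The following statements are equivalent. (i) $\{\xi_n\}$ is a Riesz-like basis and the one-to-one operator $T\in\mathcal{C}(\mathcal{D},\mathcal{H})$ for which $\{T\xi_n\}$ is an orthonormal basis of $\mathcal{H}$ has a continuous inverse, i.e. $T^{-1}\in\mathcal{C}(\mathcal{H},\mathcal{D})$ ($T^{-1}$ is defined on all of $\mathcal{H}$ and continuous from $\mathcal{H}$ into $\mathcal{D}[t]$). (ii) $\mathcal{D}$ can be endowed with an inner product $\langle\cdot,\cdot\rangle_{+1}$ such that the topology induced by the corresponding norm $\|\cdot\|_{+1}$ is equivalent to $t$, $\mathcal{D}[\|\cdot\|_{+1}]$ is a Hilbert space, and $\{\xi_n\}$ is an orthonormal basis for $\mathcal{D}[\|\cdot\|_{+1}]$. (iii) $\{\xi_n\}$ is complete (has dense linear span) in $\mathcal{D}[t]$, and there exists a continuous seminorm $p$ on $\mathcal{D}[t]$ such that for every $n\in\mathbb{N}$ and complex numbers $c_1,\dots,c_n$, $$\sum_{i=1}^n|c_i|^2\leq p\Big(\sum_{i=1}^nc_i\xi_i\Big)^2,$$ and for every continuous seminorm $q$ on $\mathcal{D}[t]$ there exists $C_q>0$ such that $$q\Big(\sum_{i=1}^nc_i\xi_i\Big)^2\leq C_q\sum_{i=1}^n|c_i|^2$$ for every $n\in\mathbb{N}$ and complex numbers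 $c_1,\dots,c_n$.
   Context: A rigged Hilbert space $\mathcal{D}[t]\subset\mathcal{H}\subset\mathcal{D}^\times[t^\times]$: $\mathcal{D}$ is a dense subspace of the Hilbert space $\mathcal{H}$ with a locally convex topology $t$ finer than the norm topology, $\mathcal{D}^\times$ is the space of continuous conjugate-linear functionals on $\mathcal{D}[t]$ with the strong dual topology $t^\times=\beta(\mathcal{D}^\times,\mathcal{D})$, and $\mathcal{H}\subset\mathcal{D}^\times$ with the duality extending the inner product. A Schauder basis of $\mathcal{D}[t]$ is a sequence $\{\xi_n\}$ such that every $f\in\mathcal{D}$ has a unique expansion $f=\sum c_n\xi_n$ converging in $\mathcal{D}[t]$ with $t$-continuous coefficient functionals. $\mathcal{C}(\mathcal{D},\mathcal{H})$ denotes the linear maps from $\mathcal{D}$ into $\mathcal{H}$ continuous from $\mathcal{D}[t]$ into $\mathcal{H}[\|\cdot\|]$ (regarded as elements of the continuous linear maps $\mathcal{D}[t]\to\mathcal{D}^\times[t^\times]$). A Schauder basis $\{\xi_n\}$ of $\mathcal{D}[t]$ is a Riesz-like basis if there exists a one-to-one $T\in\mathcal{C}(\mathcal{D},\mathcal{H})$ such that $\{T\xi_n\}$ is an orthonormal basis of $\mathcal{H}$. *)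

theory Defs
  imports "HOL-Analysis.Analysis" "HOL-Library.Function_Algebras"
begin

class cvector = ab_group_add +
  fixes scaleC :: "complex \<Rightarrow> 'a \<Rightarrow> 'a" (infixr \<open>*\<^sub>C\<close> 75)
  assumes scaleC_add_right: "a *\<^sub>C (x + y) = a *\<^sub>C x + a *\<^sub>C y"
    and scaleC_add_left: "(a + b) *\<^sub>C x = a *\<^sub>C x + b *\<^sub>C x"
    and scaleC_scaleC: "a *\<^sub>C (b *\<^sub>C x) = (a * b) *\<^sub>C x"
    and scaleC_one: "1 *\<^sub>C x = x"

instantiation complex :: cvector
begin
definition scaleC_complex :: "complex \<Rightarrow> complex \<Rightarrow> complex" where
  "scaleC_complex a z = a * z"
instance by standard (auto simp: scaleC_complex_def algebra_simps)
end

instantiation "fun" :: (type, cvector) cvector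
begin
definition scaleC_fun :: "complex \<Rightarrow> ('a \<Rightarrow> 'b) \<Rightarrow> 'a \<Rightarrow> 'b" where
  "scaleC_fun a f = (\<lambda>x. a *\<^sub>C f x)"
instance by standard (auto simp: scaleC_fun_def scaleC_add_right scaleC_add_left scaleC_scaleC scaleC_one)
end

definition csubspace :: "'a::cvector set \<Rightarrow> bool" where
  "csubspace S \<longleftrightarrow> 0 \<in> S \<and> (\<forall>x\<in>S. \<forall>y\<in>S. x + y \<in> S) \<and> (\<forall>c. \<forall>x\<in>S. c *\<^sub>C x \<in> S)"

definition clinear_on :: "'a::cvector set \<Rightarrow> ('a \<Rightarrow> 'b::cvector) \<Rightarrow> bool" where
  "clinear_on S f \<longleftrightarrow> (\<forall>x\<in>S. \<forall>y\<in>S. f (x + y) = f x + f y) \<and> (\<forall>c. \<forall>x\<in>S. f (c *\<^sub>C x) = c *\<^sub>C f x)"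

definition conj_linear_on :: "'a::cvector set \<Rightarrow> ('a \<Rightarrow> complex) \<Rightarrow> bool" where
  "conj_linear_on S F \<longleftrightarrow> (\<forall>x\<in>S. \<forall>y\<in>S. F (x + y) = F x + F y) \<and> (\<forall>c. \<forall>x\<in>S. F (c *\<^sub>C x) = cnj c * F x)"

definition cspan_seq :: "(nat \<Rightarrow> 'a::cvector) \<Rightarrow> 'a set" where
  "cspan_seq e = {x. \<exists>n c. x = (\<Sum>i<n. c i *\<^sub>C e i)}"

definition seminorm_on :: "'a::cvector set \<Rightarrow> ('a \<Rightarrow> real) \<Rightarrow> bool" where
  "seminorm_on S p \<longleftrightarrow> (\<forall>x\<in>S. 0 \<le> p x) \<and> (\<forall>x\<in>S. \<forall>y\<in>S. p (x + y) \<le> p x + p y)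
     \<and> (\<forall>c. \<forall>x\<in>S. p (c *\<^sub>C x) = cmod c * p x)"

definition sn_open :: "'a::cvector set \<Rightarrow> ('a \<Rightarrow> real) set \<Rightarrow> 'a set \<Rightarrow> bool" where
  "sn_open S P U \<longleftrightarrow> U \<subseteq> S \<and> (\<forall>x\<in>U. \<exists>F e. finite F \<and> F \<subseteq> P \<and> e > 0 \<and>
      {y\<in>S. \<forall>p\<in>F. p (y - x) < e} \<subseteq> U)"

definition sn_dense :: "'a::cvector set \<Rightarrow> ('a \<Rightarrow> real) set \<Rightarrow> 'a set \<Rightarrow> bool" where
  "sn_dense S P A \<longleftrightarrow> A \<subseteq> S \<and> (\<forall>U. sn_open S P U \<and> U \<noteq> {} \<longrightarrow> U \<inter> A \<noteq> {})"

definition sn_tendsto :: "'a::cvector set \<Rightarrow> ('a \<Rightarrow> real) set \<Rightarrow> (nat \<Rightarrow> 'a) \<Rightarrow> 'a \<Rightarrow> bool" where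
  "sn_tendsto S P s x \<longleftrightarrow> x \<in> S \<and> (\<forall>U. sn_open S P U \<and> x \<in> U \<longrightarrow> (\<forall>\<^sub>F n in sequentially. s n \<in> U))"

definition sn_cont :: "'a::cvector set \<Rightarrow> ('a \<Rightarrow> real) set \<Rightarrow> 'b::cvector set \<Rightarrow> ('b \<Rightarrow> real) set
    \<Rightarrow> ('a \<Rightarrow> 'b) \<Rightarrow> bool" where
  "sn_cont S P S' P' f \<longleftrightarrow> f ` S \<subseteq> S' \<and> (\<forall>V. sn_open S' P' V \<longrightarrow> sn_open S P {x\<in>S. f x \<in> V})"

definition cont_fun :: "'a::cvector set \<Rightarrow> ('a \<Rightarrow> real) set \<Rightarrow> ('a \<Rightarrow> 'b::topological_space) \<Rightarrow> bool" where
  "cont_fun S P f \<longleftrightarrow> (\<forall>V. open V \<longrightarrow> sn_open S P {x\<in>S. f x \<in> V})"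

definition cont_seminorm :: "'a::cvector set \<Rightarrow> ('a \<Rightarrow> real) set \<Rightarrow> ('a \<Rightarrow> real) \<Rightarrow> bool" where
  "cont_seminorm S P q \<longleftrightarrow> seminorm_on S q \<and> cont_fun S P q"

definition sn_complete :: "'a::cvector set \<Rightarrow> ('a \<Rightarrow> real) set \<Rightarrow> bool" where
  "sn_complete S P \<longleftrightarrow> (\<forall>F. F \<noteq> bot \<and> (\<forall>\<^sub>F x in F. x \<in> S) \<and>
      (\<forall>p\<in>P. \<forall>e>0. \<forall>\<^sub>F (x, y) in F \<times>\<^sub>F F. p (x - y) < e) \<longrightarrow>
      (\<exists>x\<in>S. \<forall>U. sn_open S P U \<and> x \<in> U \<longrightarrow> (\<forall>\<^sub>F y in F. y \<in> U)))"

definition sn_bounded :: "'a::cvector set \<Rightarrow> ('a \<Rightarrow> real) set \<Rightarrow> 'a set \<Rightarrow> bool" where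
  "sn_bounded S P B \<longleftrightarrow> B \<subseteq> S \<and> (\<forall>U. sn_open S P U \<and> 0 \<in> U \<longrightarrow>
      (\<exists>r>0. \<forall>c. r \<le> cmod c \<longrightarrow> B \<subseteq> (\<lambda>x. c *\<^sub>C x) ` U))"

definition cdual :: "'a::cvector set \<Rightarrow> ('a \<Rightarrow> real) set \<Rightarrow> ('a \<Rightarrow> complex) set" where
  "cdual S P = {F. conj_linear_on S F \<and> cont_fun S P F \<and> (\<forall>x. x \<notin> S \<longrightarrow> F x = 0)}"

definition strong_sn :: "'a::cvector set \<Rightarrow> ('a \<Rightarrow> real) set \<Rightarrow> (('a \<Rightarrow> complex) \<Rightarrow> real) set" where
  "strong_sn S P = {(\<lambda>F. SUP f\<in>B. cmod (F f)) | B. B \<noteq> {} \<and> sn_bounded S P B}"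

definition canon :: "'a::cvector set \<Rightarrow> ('a \<Rightarrow> real) set \<Rightarrow> 'a \<Rightarrow> (('a \<Rightarrow> complex) \<Rightarrow> complex)" where
  "canon S P f = (\<lambda>F. if F \<in> cdual S P then cnj (F f) else 0)"

definition sn_reflexive :: "'a::cvector set \<Rightarrow> ('a \<Rightarrow> real) set \<Rightarrow> bool" where
  "sn_reflexive S P \<longleftrightarrow>
     bij_betw (canon S P) S (cdual (cdual S P) (strong_sn S P)) \<and>
     (\<forall>U\<subseteq>S. sn_open S P U \<longleftrightarrow>
        sn_open (cdual (cdual S P) (strong_sn S P)) (strong_sn (cdual S P) (strong_sn S P)) (canon S P ` U))"

definition inner_on :: "'a::cvector set \<Rightarrow> ('a \<Rightarrow> 'a \<Rightarrow> complex) \<Rightarrow> bool" where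
  "inner_on S ip \<longleftrightarrow>
     (\<forall>x\<in>S. \<forall>y\<in>S. \<forall>z\<in>S. ip (x + y) z = ip x z + ip y z) \<and>
     (\<forall>c. \<forall>x\<in>S. \<forall>y\<in>S. ip (c *\<^sub>C x) y = c * ip x y) \<and>
     (\<forall>x\<in>S. \<forall>y\<in>S. ip y x = cnj (ip x y)) \<and>
     (\<forall>x\<in>S. 0 \<le> Re (ip x x)) \<and> (\<forall>x\<in>S. ip x x = 0 \<longrightarrow> x = 0)"

definition ipnorm :: "('a \<Rightarrow> 'a \<Rightarrow> complex) \<Rightarrow> 'a \<Rightarrow> real" where
  "ipnorm ip x = sqrt (Re (ip x x))"

definition ip_complete :: "'a::cvector set \<Rightarrow> ('a \<Rightarrow> 'a \<Rightarrow> complex) \<Rightarrow> bool" where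
  "ip_complete S ip \<longleftrightarrow> (\<forall>s. (\<forall>n. s n \<in> S) \<and>
      (\<forall>e>0. \<exists>N. \<forall>m\<ge>N. \<forall>n\<ge>N. ipnorm ip (s m - s n) < e) \<longrightarrow>
      (\<exists>x\<in>S. (\<lambda>n. ipnorm ip (s n - x)) \<longlonglongrightarrow> 0))"

definition hilbert_on :: "'a::cvector set \<Rightarrow> ('a \<Rightarrow> 'a \<Rightarrow> complex) \<Rightarrow> bool" where
  "hilbert_on S ip \<longleftrightarrow> csubspace S \<and> inner_on S ip \<and> ip_complete S ip"

definition onb_on :: "'a::cvector set \<Rightarrow> ('a \<Rightarrow> 'a \<Rightarrow> complex) \<Rightarrow> (nat \<Rightarrow> 'a) \<Rightarrow> bool" where
  "onb_on S ip e \<longleftrightarrow> (\<forall>n. e n \<in> S) \<and> (\<forall>i j. ip (e i) (e j) = (if i = j then 1 else 0)) \<and>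
      sn_dense S {ipnorm ip} (cspan_seq e)"

text \<open>D[t] \<subseteq> H \<subseteq> D^x[t^x]: H = UNIV with inner product ip is a Hilbert space, D a dense
  subspace, t the locally convex topology on D generated by the seminorms P, finer than the
  norm topology.\<close>
definition rigged :: "('a::cvector \<Rightarrow> 'a \<Rightarrow> complex) \<Rightarrow> 'a set \<Rightarrow> ('a \<Rightarrow> real) set \<Rightarrow> bool" where
  "rigged ip D P \<longleftrightarrow> hilbert_on UNIV ip \<and> csubspace D \<and> sn_dense UNIV {ipnorm ip} D \<and>
     (\<forall>p\<in>P. seminorm_on D p) \<and> (\<forall>U. sn_open D {ipnorm ip} U \<longrightarrow> sn_open D P U)"

definition schauder_basis :: "'a::cvector set \<Rightarrow> ('a \<Rightarrow> real) set \<Rightarrow> (nat \<Rightarrow> 'a) \<Rightarrow> bool" where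
  "schauder_basis D P \<xi> \<longleftrightarrow> (\<forall>n. \<xi> n \<in> D) \<and>
     (\<exists>c :: nat \<Rightarrow> 'a \<Rightarrow> complex. (\<forall>n. cont_fun D P (c n)) \<and>
        (\<forall>f\<in>D. sn_tendsto D P (\<lambda>N. \<Sum>n<N. c n f *\<^sub>C \<xi> n) f) \<and>
        (\<forall>f\<in>D. \<forall>a. sn_tendsto D P (\<lambda>N. \<Sum>n<N. a n *\<^sub>C \<xi> n) f \<longrightarrow> a = (\<lambda>n. c n f)))"

definition riesz_op :: "('a::cvector \<Rightarrow> 'a \<Rightarrow> complex) \<Rightarrow> 'a set \<Rightarrow> ('a \<Rightarrow> real) set \<Rightarrow> (nat \<Rightarrow> 'a)
    \<Rightarrow> ('a \<Rightarrow> 'a) \<Rightarrow> bool" where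
  "riesz_op ip D P \<xi> T \<longleftrightarrow> clinear_on D T \<and> sn_cont D P UNIV {ipnorm ip} T \<and> inj_on T D \<and>
     onb_on UNIV ip (\<lambda>n. T (\<xi> n))"

definition riesz_like :: "('a::cvector \<Rightarrow> 'a \<Rightarrow> complex) \<Rightarrow> 'a set \<Rightarrow> ('a \<Rightarrow> real) set \<Rightarrow> (nat \<Rightarrow> 'a) \<Rightarrow> bool" where
  "riesz_like ip D P \<xi> \<longleftrightarrow> schauder_basis D P \<xi> \<and> (\<exists>T. riesz_op ip D P \<xi> T)"

end

theory Submission
  imports Defs
begin

text \<open>
  If $T$ is as in (i), the pulled back inner product $\langle Tx, Ty\rangle$ is the one
  required in (ii).  For the converse, orthonormalise the sequence $\xi$ inside $H$ by Gram-Schmidt: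
  the result is an orthonormal basis of $H$ because $\xi$ spans a dense subspace of $D$, hence of $H$,
  and the unitary operator mapping one orthonormal basis to the other is the required $T$.

  From (ii) to (iii) take the Hilbert norm for $p$.  Conversely, the bounds in (iii) say that on the span
  of $\xi$ the $\ell^2$ norm of the coefficients is equivalent to $p$ and dominates every continuous
  seminorm.  So $p$ is a norm that generates the topology of $D$, and the $\ell^2$ inner product of the
  coefficients extends from the span to $D$ by continuity.
\<close>

text \<open>The operator in (i) must land in the very space \<open>H\<close> that contains
  \<open>D\<close>, so an orthonormal basis of \<open>H\<close> indexed by the naturals has to be
  produced before an isometry can be written down. The sequence \<open>\<xi>\<close> is linearly
  independent because it is orthonormal for the product of (ii); Gram-Schmidt is then run with the
  other product, that of \<open>H\<close>.

  The delicate direction starts from (iii). The seminorm \<open>p\<close> is not assumed to separate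
  points, and it need not come from an inner product. Comparing the two bounds on the span and
  passing to \<open>D\<close> by density shows that every continuous seminorm is at most a multiple
  of \<open>p\<close>. Applied to the norm of \<open>H\<close>, which is continuous because
  \<open>t\<close> is finer, this makes \<open>p\<close> definite on all of \<open>D\<close>, not
  merely on the span. Definiteness of the extended product rests on it: a limit of positive definite
  forms is a priori only semidefinite. Completeness of \<open>D[t]\<close>, phrased with Cauchy
  filters, is then applied to the filter generated by a norm-Cauchy sequence.\<close>

section \<open>Complex subspaces and linear spans\<close>

global_interpretation cvec: vector_space "scaleC :: complex \<Rightarrow> 'a \<Rightarrow> 'a::cvector"
  by unfold_locales (auto simp: scaleC_add_right scaleC_add_left scaleC_scaleC scaleC_one)

lemma csubspace_iff: "csubspace S \<longleftrightarrow> cvec.subspace S"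
  by (auto simp: csubspace_def cvec.subspace_def)

text \<open>Combinations of an initial segment exhaust the span because missing coefficients may be
  set to zero. Padding in this way is also how two sums of different length are added.\<close>

lemma cspan_seq_eq_span: "cspan_seq e = cvec.span (range e)"
proof
  show "cspan_seq e \<subseteq> cvec.span (range e)"
    by (auto simp: cspan_seq_def intro!: cvec.span_sum cvec.span_scale intro: cvec.span_base)
  have add: "x + y \<in> cspan_seq e" if "x \<in> cspan_seq e" "y \<in> cspan_seq e" for x y
  proof -
    from that obtain n c m d where x: "x = (\<Sum>i<n. c i *\<^sub>C e i)" and y: "y = (\<Sum>i<m. d i *\<^sub>C e i)"
      unfolding cspan_seq_def by blast
    have "x = (\<Sum>i<n+m. (if i < n then c i else 0) *\<^sub>C e i)"
      unfolding x by (rule sum.mono_neutral_cong_left) auto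
    moreover have "y = (\<Sum>i<n+m. (if i < m then d i else 0) *\<^sub>C e i)"
      unfolding y by (rule sum.mono_neutral_cong_left) auto
    ultimately have "x + y = (\<Sum>i<n+m. ((if i < n then c i else 0) + (if i < m then d i else 0)) *\<^sub>C e i)"
      by (simp add: scaleC_add_left sum.distrib)
    then show ?thesis unfolding cspan_seq_def by (auto intro: exI[of _ "n+m"])
  qed
  have "cvec.subspace (cspan_seq e)"
    unfolding cvec.subspace_def
  proof (intro conjI ballI allI)
    show "0 \<in> cspan_seq e" unfolding cspan_seq_def by (auto intro: exI[of _ 0])
    show "a *\<^sub>C x \<in> cspan_seq e" if "x \<in> cspan_seq e" for a x
    proof -
      from that obtain n c where "x = (\<Sum>i<n. c i *\<^sub>C e i)" unfolding cspan_seq_def by blast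
      then have "a *\<^sub>C x = (\<Sum>i<n. (a * c i) *\<^sub>C e i)" by (simp add: cvec.scale_sum_right)
      then show ?thesis unfolding cspan_seq_def by (auto intro: exI[of _ n])
    qed
  qed (rule add)
  moreover have "e k \<in> cspan_seq e" for k
  proof -
    have "e k = (\<Sum>i<Suc k. (if i = k then 1 else 0) *\<^sub>C e i)" by (simp add: sum.neutral)
    then show ?thesis unfolding cspan_seq_def
      by (intro CollectI exI[of _ "Suc k"] exI[of _ "\<lambda>i. if i = k then 1 else 0"])
  qed
  ultimately show "cvec.span (range e) \<subseteq> cspan_seq e"
    by (intro cvec.span_minimal) auto
qed

lemma csubspace_cspan_seq: "csubspace (cspan_seq e)"
  by (simp add: cspan_seq_eq_span csubspace_iff)

lemma cspan_seq_base: "e n \<in> cspan_seq e"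
  by (simp add: cspan_seq_eq_span cvec.span_base)

subsection \<open>Topologies generated by seminorms\<close>

text \<open>A finite subfamily of \<open>{p}\<close> is empty or \<open>{p}\<close> itself, and
  enlarging it to \<open>{p}\<close> only shrinks the basic neighbourhood.\<close>

lemma sn_open_single:
  "sn_open S {p} U \<longleftrightarrow> U \<subseteq> S \<and> (\<forall>x\<in>U. \<exists>e>0. {y\<in>S. p (y - x) < e} \<subseteq> U)"
proof -
  have "(\<exists>F e. finite F \<and> F \<subseteq> {p} \<and> e > 0 \<and> {y\<in>S. \<forall>p\<in>F. p (y - x) < e} \<subseteq> U)
     \<longleftrightarrow> (\<exists>e>0. {y\<in>S. p (y - x) < e} \<subseteq> U)" for x
  proof
    assume "\<exists>F e. finite F \<and> F \<subseteq> {p} \<and> e > 0 \<and> {y\<in>S. \<forall>p\<in>F. p (y - x) < e} \<subseteq> U"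
    then obtain F and e :: real where "F \<subseteq> {p}" "e > 0" "{y\<in>S. \<forall>p\<in>F. p (y - x) < e} \<subseteq> U" by blast
    then show "\<exists>e>0. {y\<in>S. p (y - x) < e} \<subseteq> U" by (intro exI[of _ e]) blast
  next
    assume "\<exists>e>0. {y\<in>S. p (y - x) < e} \<subseteq> U"
    then obtain e :: real where "e > 0" "{y\<in>S. p (y - x) < e} \<subseteq> U" by blast
    then show "\<exists>F e. finite F \<and> F \<subseteq> {p} \<and> e > 0 \<and> {y\<in>S. \<forall>p\<in>F. p (y - x) < e} \<subseteq> U"
      by (intro exI[of _ "{p}"] exI[of _ e]) auto
  qed
  then show ?thesis by (simp only: sn_open_def)
qed

locale complex_subspace =
  fixes S :: "'a::cvector set"
  assumes subspace: "csubspace S"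
begin

lemma mem [simp, intro]:
  "0 \<in> S" "x \<in> S \<Longrightarrow> y \<in> S \<Longrightarrow> x + y \<in> S" "x \<in> S \<Longrightarrow> y \<in> S \<Longrightarrow> x - y \<in> S"
  "x \<in> S \<Longrightarrow> - x \<in> S" "x \<in> S \<Longrightarrow> c *\<^sub>C x \<in> S"
  using subspace unfolding csubspace_iff
  by (auto intro: cvec.subspace_0 cvec.subspace_add cvec.subspace_diff cvec.subspace_neg cvec.subspace_scale)

lemma sum_mem [intro]: "(\<And>i. i \<in> I \<Longrightarrow> x i \<in> S) \<Longrightarrow> (\<Sum>i\<in>I. x i) \<in> S"
  using subspace unfolding csubspace_iff by (auto intro: cvec.subspace_sum)

end

locale seminormed = complex_subspace S for S :: "'a::cvector set" +
  fixes p :: "'a \<Rightarrow> real"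
  assumes seminorm: "seminorm_on S p"
begin

lemma nonneg [simp]: "x \<in> S \<Longrightarrow> 0 \<le> p x"
  and triangle: "x \<in> S \<Longrightarrow> y \<in> S \<Longrightarrow> p (x + y) \<le> p x + p y"
  and scale: "x \<in> S \<Longrightarrow> p (c *\<^sub>C x) = cmod c * p x"
  using seminorm unfolding seminorm_on_def by auto

lemma zero [simp]: "p 0 = 0"
  using scale[of 0 0] by simp

lemma minus: "x \<in> S \<Longrightarrow> p (- x) = p x"
  using scale[of x "-1"] by (simp add: cvec.scale_minus_left)

lemma diff_commute: "x \<in> S \<Longrightarrow> y \<in> S \<Longrightarrow> p (x - y) = p (y - x)"
  using minus[of "x - y"] by simp

lemma triangle_diff: "x \<in> S \<Longrightarrow> y \<in> S \<Longrightarrow> p (x - y) \<le> p x + p y"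
  using triangle[of x "- y"] minus[of y] by simp

lemma triangle_mid: "x \<in> S \<Longrightarrow> y \<in> S \<Longrightarrow> z \<in> S \<Longrightarrow> p (x - z) \<le> p (x - y) + p (y - z)"
  using triangle[of "x - y" "y - z"] by simp

lemma abs_diff: "x \<in> S \<Longrightarrow> y \<in> S \<Longrightarrow> \<bar>p x - p y\<bar> \<le> p (x - y)"
  using triangle[of "x - y" y] triangle[of "y - x" x] diff_commute[of x y] by simp

lemma ball_open:
  assumes "x \<in> S" shows "sn_open S {p} {y\<in>S. p (y - x) < e}"
  unfolding sn_open_single
proof (intro conjI ballI)
  fix y assume y: "y \<in> {y\<in>S. p (y - x) < e}"
  have "p (z - x) < e" if "z \<in> S" "p (z - y) < e - p (y - x)" for z
    using triangle_mid[of z y x] that y assms by auto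
  then show "\<exists>d>0. {z\<in>S. p (z - y) < d} \<subseteq> {y\<in>S. p (y - x) < e}"
    using y by (intro exI[of _ "e - p (y - x)"]) auto
qed auto

lemma tendsto_iff:
  assumes "\<And>n. s n \<in> S"
  shows "sn_tendsto S {p} s x \<longleftrightarrow> x \<in> S \<and> (\<lambda>n. p (s n - x)) \<longlonglongrightarrow> 0"
proof
  assume L: "sn_tendsto S {p} s x"
  then have x: "x \<in> S" by (simp add: sn_tendsto_def)
  have "\<forall>\<^sub>F n in sequentially. dist (p (s n - x)) 0 < e" if "e > 0" for e
    using L ball_open[OF x, of e] that x assms unfolding sn_tendsto_def
    by (auto elim!: allE[of _ "{y\<in>S. p (y - x) < e}"] eventually_mono)
  then show "x \<in> S \<and> (\<lambda>n. p (s n - x)) \<longlonglongrightarrow> 0" using x by (auto intro: tendstoI)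
next
  assume R: "x \<in> S \<and> (\<lambda>n. p (s n - x)) \<longlonglongrightarrow> 0"
  show "sn_tendsto S {p} s x" unfolding sn_tendsto_def
  proof (intro conjI allI impI)
    fix U assume U: "sn_open S {p} U \<and> x \<in> U"
    then obtain e where e: "e > 0" "{y\<in>S. p (y - x) < e} \<subseteq> U" unfolding sn_open_single by blast
    from R e have "\<forall>\<^sub>F n in sequentially. p (s n - x) < e" by (auto dest: order_tendstoD(2))
    then show "\<forall>\<^sub>F n in sequentially. s n \<in> U" by eventually_elim (use e assms in auto)
  qed (use R in auto)
qed

lemma denseD:
  assumes "sn_dense S {p} A" "x \<in> S" "e > 0"
  obtains a where "a \<in> A" "a \<in> S" "p (a - x) < e"
proof -
  have "{y\<in>S. p (y - x) < e} \<noteq> {}" using assms by (auto intro!: exI[of _ x])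
  then have "{y\<in>S. p (y - x) < e} \<inter> A \<noteq> {}"
    using assms(1) ball_open[OF assms(2)] unfolding sn_dense_def by blast
  with that show thesis by blast
qed

lemma lipschitz_cont_fun:
  fixes f :: "'a \<Rightarrow> 'b::metric_space"
  assumes "\<And>x y. x \<in> S \<Longrightarrow> y \<in> S \<Longrightarrow> dist (f x) (f y) \<le> p (x - y)"
  shows "cont_fun S {p} f"
  unfolding cont_fun_def sn_open_single
proof (intro allI impI conjI ballI)
  fix V x assume "open (V :: 'b set)" "x \<in> {x\<in>S. f x \<in> V}"
  then obtain e where "e > 0" "ball (f x) e \<subseteq> V" "x \<in> S" by (auto simp: open_contains_ball)
  then show "\<exists>e>0. {y\<in>S. p (y - x) < e} \<subseteq> {x\<in>S. f x \<in> V}"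
    using assms[of x] diff_commute[of x] by (intro exI[of _ e]) (force simp: subset_iff)
qed auto

lemma cont_seminorm_self: "cont_seminorm S {p} p"
  unfolding cont_seminorm_def using seminorm by (auto intro!: lipschitz_cont_fun simp: dist_real_def abs_diff)

text \<open>Continuity at the origin gives \<open>q < 1\<close> on a \<open>p\<close>-ball of radius
  \<open>e\<close>; by homogeneity \<open>1 / e\<close> is then a bound on all of
  \<open>S\<close>.\<close>

lemma cont_seminorm_bound:
  assumes "cont_seminorm S {p} q"
  obtains C where "C > 0" "\<And>x. x \<in> S \<Longrightarrow> q x \<le> C * p x"
proof -
  interpret q: seminormed S q
    using assms subspace by unfold_locales (auto simp: cont_seminorm_def)
  have "sn_open S {p} {x\<in>S. q x \<in> {..<1}}"
    using assms open_lessThan unfolding cont_seminorm_def cont_fun_def by blast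
  then obtain e where e: "e > 0" "{y\<in>S. p (y - 0) < e} \<subseteq> {x\<in>S. q x \<in> {..<1}}"
    unfolding sn_open_single by (auto dest!: bspec[of _ _ 0])
  have "q x \<le> (1 / e) * p x" if x: "x \<in> S" for x
  proof (rule field_le_epsilon)
    \<comment> \<open>Since \<open>p x\<close> may vanish, \<open>x\<close> cannot be normalised by
      it. The slack \<open>d\<close> keeps the denominator of \<open>t\<close> positive, and
      \<open>t\<close> scales \<open>x\<close> strictly into the ball.\<close>
    fix d :: real assume d: "d > 0"
    define t where "t = 1 / (p x / e + d)"
    have t: "t > 0" unfolding t_def using d x e by (auto intro!: divide_pos_pos add_nonneg_pos)
    have "p x * t < e"
    proof -
      have "p x / e < 1 / t" unfolding t_def using d by simp
      then show ?thesis using t e by (simp add: field_simps)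
    qed
    then have "p (complex_of_real t *\<^sub>C x) < e" using t x by (simp add: scale mult.commute)
    then have "q (complex_of_real t *\<^sub>C x) < 1" using e x by auto
    then have "t * q x < 1" using t x by (simp add: q.scale)
    then have "q x < 1 / t" using t by (simp add: field_simps)
    then show "q x \<le> (1 / e) * p x + d" unfolding t_def by simp
  qed
  with e that[of "1/e"] show thesis by auto
qed

end

text \<open>Continuity, density and convergence are defined through open sets alone. This and the
  following congruences carry them between the family \<open>P\<close> and a single norm with the
  same topology.\<close>

lemma cont_fun_cong:
  assumes "\<And>U. sn_open S P U \<longleftrightarrow> sn_open S Q U"
  shows "cont_fun S P f \<longleftrightarrow> cont_fun S Q f"
  using assms by (simp add: cont_fun_def)

lemma cont_seminorm_cong:
  assumes "\<And>U. sn_open S P U \<longleftrightarrow> sn_open S Q U"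
  shows "cont_seminorm S P f \<longleftrightarrow> cont_seminorm S Q f"
  using assms by (simp add: cont_seminorm_def cont_fun_def)

lemma sn_dense_cong:
  assumes "\<And>U. sn_open S P U \<longleftrightarrow> sn_open S Q U"
  shows "sn_dense S P A \<longleftrightarrow> sn_dense S Q A"
  using assms by (simp add: sn_dense_def)

lemma sn_tendsto_cong:
  assumes "\<And>U. sn_open S P U \<longleftrightarrow> sn_open S Q U"
  shows "sn_tendsto S P s x \<longleftrightarrow> sn_tendsto S Q s x"
  using assms by (simp add: sn_tendsto_def)

lemma sn_cont_cong:
  assumes "\<And>U. sn_open S P U \<longleftrightarrow> sn_open S Q U" "\<And>U. sn_open S' P' U \<longleftrightarrow> sn_open S' Q' U"
  shows "sn_cont S P S' P' f \<longleftrightarrow> sn_cont S Q S' Q' f"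
  using assms by (simp add: sn_cont_def)

text \<open>Constant 1 in the bound is what the applications to isometries call for.\<close>

lemma bounded_linear_sn_cont:
  assumes S: "csubspace S" and f: "clinear_on S f" "f ` S \<subseteq> S'"
    and bd: "\<And>x. x \<in> S \<Longrightarrow> p' (f x) \<le> p x"
  shows "sn_cont S {p} S' {p'} f"
  unfolding sn_cont_def sn_open_single
proof (intro conjI allI impI ballI f(2))
  fix V x assume V: "V \<subseteq> S' \<and> (\<forall>x\<in>V. \<exists>e>0. {y\<in>S'. p' (y - x) < e} \<subseteq> V)" and x: "x \<in> {x\<in>S. f x \<in> V}"
  then obtain e where e: "e > 0" "{y\<in>S'. p' (y - f x) < e} \<subseteq> V" by blast
  have "f (y - x) = f y - f x" "y - x \<in> S" if "y \<in> S" for y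
  proof -
    show "y - x \<in> S" using S that x by (auto simp: csubspace_iff cvec.subspace_diff)
    then have "f ((y - x) + x) = f (y - x) + f x" using f x unfolding clinear_on_def by blast
    then show "f (y - x) = f y - f x" by simp
  qed
  then have "{y\<in>S. p (y - x) < e} \<subseteq> {x\<in>S. f x \<in> V}"
    using e(2) f(2) bd by (fastforce simp: subset_iff)
  with e show "\<exists>e>0. {y\<in>S. p (y - x) < e} \<subseteq> {x\<in>S. f x \<in> V}" by blast
qed auto

subsection \<open>Locally convex topologies given by a family of seminorms\<close>

lemma member_cont_seminorm:
  assumes S: "csubspace S" and P: "\<forall>p\<in>P. seminorm_on S p" and q: "q \<in> P"
  shows "cont_seminorm S P q"
proof -
  interpret seminormed S q using assms by unfold_locales auto
  have "sn_open S P U" if "sn_open S {q} U" for U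
    unfolding sn_open_def
  proof (intro conjI ballI)
    show "U \<subseteq> S" using that by (simp add: sn_open_def)
    fix x assume "x \<in> U"
    with that obtain e where "e > 0" "{y\<in>S. q (y - x) < e} \<subseteq> U" unfolding sn_open_single by blast
    then show "\<exists>F e. finite F \<and> F \<subseteq> P \<and> e > 0 \<and> {y\<in>S. \<forall>p\<in>F. p (y - x) < e} \<subseteq> U"
      using q by (intro exI[of _ "{q}"] exI[of _ e]) simp
  qed
  then show ?thesis using cont_seminorm_self by (auto simp: cont_seminorm_def cont_fun_def)
qed

text \<open>Continuity of \<open>q\<close> only concerns the sets where \<open>q y < e\<close>, that
  is, balls about the origin. Basic neighbourhoods are translation invariant, which moves the ball
  to \<open>x\<close>.\<close>

lemma cont_seminorm_ball_open:
  assumes S: "csubspace S" and q: "cont_seminorm S P q" and x: "x \<in> S"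
  shows "sn_open S P {y\<in>S. q (y - x) < e}"
proof -
  have op: "sn_open S P {y\<in>S. q y \<in> {..<e}}"
    using q open_lessThan unfolding cont_seminorm_def cont_fun_def by blast
  have sub: "a - b \<in> S" if "a \<in> S" "b \<in> S" for a b
    using S that by (auto simp: csubspace_iff cvec.subspace_diff)
  show ?thesis unfolding sn_open_def
  proof (intro conjI ballI)
    fix y assume "y \<in> {y\<in>S. q (y - x) < e}"
    then have "y - x \<in> {y\<in>S. q y \<in> {..<e}}" using x sub by auto
    then obtain F d where F: "finite F" "F \<subseteq> P" "d > 0"
      "{z\<in>S. \<forall>p\<in>F. p (z - (y - x)) < d} \<subseteq> {y\<in>S. q y \<in> {..<e}}"
      using op unfolding sn_open_def by blast
    have "{z\<in>S. \<forall>p\<in>F. p (z - y) < d} \<subseteq> {y\<in>S. q (y - x) < e}"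
    proof clarify
      fix z assume "z \<in> S" "\<forall>p\<in>F. p (z - y) < d"
      then have "z - x \<in> {z\<in>S. \<forall>p\<in>F. p (z - (y - x)) < d}" using sub x by simp
      with F(4) show "q (z - x) < e" by auto
    qed
    with F show "\<exists>F d. finite F \<and> F \<subseteq> P \<and> d > 0 \<and> {z\<in>S. \<forall>p\<in>F. p (z - y) < d} \<subseteq> {y\<in>S. q (y - x) < e}"
      by blast
  qed auto
qed

lemma sn_open_Int:
  assumes "sn_open S P U" "sn_open S P V"
  shows "sn_open S P (U \<inter> V)"
  unfolding sn_open_def
proof (intro conjI ballI)
  fix x assume "x \<in> U \<inter> V"
  then have x: "x \<in> U" "x \<in> V" by simp_all
  obtain F d where F: "finite F" "F \<subseteq> P" "d > 0" "{y\<in>S. \<forall>p\<in>F. p (y - x) < d} \<subseteq> U"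
    using assms(1) x(1) unfolding sn_open_def by blast
  obtain G e where G: "finite G" "G \<subseteq> P" "e > 0" "{y\<in>S. \<forall>p\<in>G. p (y - x) < e} \<subseteq> V"
    using assms(2) x(2) unfolding sn_open_def by blast
  from F G have "{y\<in>S. \<forall>p\<in>F \<union> G. p (y - x) < min d e} \<subseteq> U \<inter> V" by auto
  with F G show "\<exists>F e. finite F \<and> F \<subseteq> P \<and> e > 0 \<and> {y\<in>S. \<forall>p\<in>F. p (y - x) < e} \<subseteq> U \<inter> V"
    by (intro exI[of _ "F \<union> G"] exI[of _ "min d e"]) simp
qed (use assms in \<open>auto simp: sn_open_def\<close>)

text \<open>Two inequalities give equal topologies: \<open>N \<le> q\<close> puts a
  \<open>q\<close>-ball inside each \<open>N\<close>-ball, and finitely many members of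
  \<open>P\<close> are bounded by one multiple of \<open>N\<close>.\<close>

lemma sn_open_iff_dominating_norm:
  assumes S: "csubspace S" and P: "\<forall>p\<in>P. seminorm_on S p"
    and N: "seminorm_on S N" and q: "cont_seminorm S P q"
    and Nq: "\<And>x. x \<in> S \<Longrightarrow> N x \<le> q x"
    and PN: "\<And>p. p \<in> P \<Longrightarrow> \<exists>C>0. \<forall>x\<in>S. p x \<le> C * N x"
  shows "sn_open S {N} U \<longleftrightarrow> sn_open S P U"
proof
  interpret N: seminormed S N using S N by unfold_locales
  assume U: "sn_open S {N} U"
  show "sn_open S P U" unfolding sn_open_def
  proof (intro conjI ballI)
    show US: "U \<subseteq> S" using U by (simp add: sn_open_def)
    fix x assume x: "x \<in> U"
    then obtain e where e: "e > 0" "{y\<in>S. N (y - x) < e} \<subseteq> U" using U unfolding sn_open_single by blast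
    have xS: "x \<in> S" using x US by auto
    interpret q: seminormed S q using S q by unfold_locales (simp_all add: cont_seminorm_def)
    have "q (x - x) = 0" by simp
    then have "x \<in> {y\<in>S. q (y - x) < e}" using xS e by auto
    with cont_seminorm_ball_open[OF S q xS, of e]
    obtain F d where F: "finite F" "F \<subseteq> P" "d > 0" "{y\<in>S. \<forall>p\<in>F. p (y - x) < d} \<subseteq> {y\<in>S. q (y - x) < e}"
      unfolding sn_open_def by blast
    have "{y\<in>S. q (y - x) < e} \<subseteq> U" using e(2) order.strict_trans1[OF Nq] xS by (blast intro: N.mem)
    with F show "\<exists>F e. finite F \<and> F \<subseteq> P \<and> e > 0 \<and> {y\<in>S. \<forall>p\<in>F. p (y - x) < e} \<subseteq> U" by blast
  qed
next
  interpret N: seminormed S N using S N by unfold_locales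
  assume U: "sn_open S P U"
  show "sn_open S {N} U" unfolding sn_open_single
  proof (intro conjI ballI)
    show US: "U \<subseteq> S" using U by (simp add: sn_open_def)
    fix x assume x: "x \<in> U"
    then obtain F e where F: "finite F" "F \<subseteq> P" "e > 0" "{y\<in>S. \<forall>p\<in>F. p (y - x) < e} \<subseteq> U"
      using U unfolding sn_open_def by blast
    \<comment> \<open>A basic neighbourhood involves several seminorms, so a common constant is
      needed; adding the individual constants serves as well as their maximum.\<close>
    have "\<exists>K>0. \<forall>p\<in>F. \<forall>x\<in>S. p x \<le> K * N x"
      using F(1,2)
    proof induction
      case empty show ?case by (auto intro: exI[of _ 1])
    next
      case (insert p F)
      then obtain K where K: "K > 0" "\<forall>p\<in>F. \<forall>x\<in>S. p x \<le> K * N x" by auto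
      obtain C where C: "C > 0" "\<forall>x\<in>S. p x \<le> C * N x" using PN insert.prems by blast
      have "C * N x \<le> (K + C) * N x" "K * N x \<le> (K + C) * N x" if "x \<in> S" for x
        using that K C by (auto intro!: mult_right_mono)
      then have "\<forall>p'\<in>insert p F. \<forall>x\<in>S. p' x \<le> (K + C) * N x"
        using K(2) C(2) by (metis insert_iff order_trans)
      then show ?case using K C by (intro exI[of _ "K + C"]) auto
    qed
    then obtain K where K: "K > 0" "\<forall>p\<in>F. \<forall>x\<in>S. p x \<le> K * N x" by blast
    have "p (y - x) < e" if "y \<in> S" "N (y - x) < e / K" "p \<in> F" for y p
    proof -
      have "p (y - x) \<le> K * N (y - x)" using K that x US by auto
      also have "\<dots> < e" using that K by (simp add: field_simps)
      finally show ?thesis .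
    qed
    then show "\<exists>e>0. {y\<in>S. N (y - x) < e} \<subseteq> U"
      using F K by (intro exI[of _ "e / K"]) auto
  qed
qed

subsection \<open>Inner products\<close>

text \<open>The carrier \<open>S\<close> is a parameter because the same theory is applied to
  \<open>H\<close>, to \<open>D\<close> with two different products, and to the span of
  \<open>\<xi>\<close>.\<close>

locale cinner = complex_subspace S for S :: "'a::cvector set" +
  fixes ip :: "'a \<Rightarrow> 'a \<Rightarrow> complex"
  assumes inner: "inner_on S ip"
begin

abbreviation nm :: "'a \<Rightarrow> real" where "nm \<equiv> ipnorm ip"

lemmas
  ip_add_left = inner[unfolded inner_on_def, THEN conjunct1, rule_format] and
  ip_scale_left = inner[unfolded inner_on_def, THEN conjunct2, THEN conjunct1, rule_format] and
  ip_cnj = inner[unfolded inner_on_def, THEN conjunct2, THEN conjunct2, THEN conjunct1, rule_format] and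
  ip_self_nonneg = inner[unfolded inner_on_def, THEN conjunct2, THEN conjunct2, THEN conjunct2,
    THEN conjunct1, rule_format] and
  ip_zero_imp = inner[unfolded inner_on_def, THEN conjunct2, THEN conjunct2, THEN conjunct2,
    THEN conjunct2, rule_format]

lemma
  assumes "x \<in> S" "y \<in> S"
  shows ip_add_right: "z \<in> S \<Longrightarrow> ip x (y + z) = ip x y + ip x z"
    and ip_scale_right: "ip x (c *\<^sub>C y) = cnj c * ip x y"
proof -
  show "ip x (y + z) = ip x y + ip x z" if "z \<in> S"
    using ip_cnj[of "y + z" x] ip_cnj[of y x] ip_cnj[of z x] ip_add_left[of y z x] that assms by simp
  show "ip x (c *\<^sub>C y) = cnj c * ip x y"
    using ip_cnj[of "c *\<^sub>C y" x] ip_cnj[of y x] ip_scale_left[of y x c] assms by simp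
qed

lemma ip_zero_left [simp]: "x \<in> S \<Longrightarrow> ip 0 x = 0"
  and ip_zero_right [simp]: "x \<in> S \<Longrightarrow> ip x 0 = 0"
  using ip_scale_left[of 0 x 0] ip_scale_right[of x 0 0] by simp_all

lemma
  assumes "x \<in> S" "y \<in> S" "z \<in> S"
  shows ip_diff_left: "ip (x - y) z = ip x z - ip y z"
    and ip_diff_right: "ip x (y - z) = ip x y - ip x z"
  using ip_add_left[of "x - y" y z] ip_add_right[of x "y - z" z] assms by (simp_all add: algebra_simps)

lemma ip_sum_left:
  assumes "finite I" "\<And>i. i \<in> I \<Longrightarrow> x i \<in> S" "y \<in> S"
  shows "ip (\<Sum>i\<in>I. x i) y = (\<Sum>i\<in>I. ip (x i) y)"
  using assms by (induction I rule: finite_induct) (auto simp: ip_add_left sum_mem)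

lemma ip_self: "x \<in> S \<Longrightarrow> ip x x = complex_of_real ((nm x)\<^sup>2)"
  using ip_cnj[of x x] ip_self_nonneg[of x] by (simp add: ipnorm_def complex_eq_iff)

lemma nm_power2: "x \<in> S \<Longrightarrow> (nm x)\<^sup>2 = Re (ip x x)"
  using ip_self_nonneg[of x] by (simp add: ipnorm_def)

lemma nm_nonneg: "x \<in> S \<Longrightarrow> 0 \<le> nm x"
  using ip_self_nonneg by (simp add: ipnorm_def)

lemma nm_eq_0_imp: "x \<in> S \<Longrightarrow> nm x = 0 \<Longrightarrow> x = 0"
  using ip_self[of x] ip_zero_imp by simp

lemma Cauchy_Schwarz:
  assumes x: "x \<in> S" and y: "y \<in> S"
  shows "cmod (ip x y) \<le> nm x * nm y"
proof (cases "y = 0")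
  case True then show ?thesis using x nm_nonneg by simp
next
  case False
  define b where "b = (nm y)\<^sup>2"
  have b: "b > 0" unfolding b_def zero_less_power2 using False nm_eq_0_imp[OF y] by blast
  define z where "z = ip x y"
  \<comment> \<open>The coefficient of the orthogonal projection of \<open>x\<close> onto the line
    through \<open>y\<close>.\<close>
  define c where "c = z / of_real b"
  have "ip (x - c *\<^sub>C y) (x - c *\<^sub>C y) = ip x x - cnj c * z - c * cnj z + c * cnj c * of_real b"
    using x y ip_self[OF y] ip_cnj[of x y]
    by (simp add: ip_diff_left ip_diff_right ip_scale_left ip_scale_right z_def b_def algebra_simps)
  also have "\<dots> = ip x x - z * cnj z / of_real b"
    using b by (simp add: c_def field_simps)
  also have "\<dots> = of_real ((nm x)\<^sup>2 - (cmod z)\<^sup>2 / b)"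
    using ip_self[OF x] by (simp add: complex_mult_cnj cmod_power2)
  finally have "0 \<le> (nm x)\<^sup>2 - (cmod z)\<^sup>2 / b"
    using ip_self_nonneg[of "x - c *\<^sub>C y"] x y by (metis Re_complex_of_real mem(3,5))
  then have "(cmod z)\<^sup>2 \<le> (nm x * nm y)\<^sup>2"
    using b by (simp add: field_simps b_def)
  then show ?thesis unfolding z_def by (rule power2_le_imp_le) (use x y nm_nonneg in simp)
qed

lemma nm_scale: "x \<in> S \<Longrightarrow> nm (c *\<^sub>C x) = cmod c * nm x"
proof -
  assume x: "x \<in> S"
  have "ip (c *\<^sub>C x) (c *\<^sub>C x) = of_real ((cmod c)\<^sup>2 * (nm x)\<^sup>2)"
    using x ip_self[OF x] by (simp add: ip_scale_left ip_scale_right mult_ac flip: complex_norm_square)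
  then have "(nm (c *\<^sub>C x))\<^sup>2 = (cmod c * nm x)\<^sup>2"
    using x by (simp add: nm_power2[of "c *\<^sub>C x"] power_mult_distrib)
  then show ?thesis using x nm_nonneg by (simp add: power2_eq_iff_nonneg)
qed

lemma nm_add_power2:
  assumes "x \<in> S" "y \<in> S"
  shows "(nm (x + y))\<^sup>2 = (nm x)\<^sup>2 + (nm y)\<^sup>2 + 2 * Re (ip x y)"
  using assms ip_cnj[of x y] by (simp add: nm_power2 ip_add_left ip_add_right)

lemma nm_triangle:
  assumes "x \<in> S" "y \<in> S"
  shows "nm (x + y) \<le> nm x + nm y"
proof (rule power2_le_imp_le)
  have "Re (ip x y) \<le> nm x * nm y"
    using Cauchy_Schwarz[OF assms] complex_Re_le_cmod[of "ip x y"] by linarith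
  then show "(nm (x + y))\<^sup>2 \<le> (nm x + nm y)\<^sup>2"
    using nm_add_power2[OF assms] by (simp add: power2_sum)
qed (use assms nm_nonneg in simp)

sublocale seminormed S "ipnorm ip"
  by unfold_locales (auto simp: seminorm_on_def nm_nonneg nm_scale nm_triangle)

lemma ip_tendsto_left:
  assumes s: "\<And>n. s n \<in> S" and x: "x \<in> S" and y: "y \<in> S" and lim: "(\<lambda>n. nm (s n - x)) \<longlonglongrightarrow> 0"
  shows "(\<lambda>n. ip (s n) y) \<longlonglongrightarrow> ip x y"
proof (rule LIM_zero_cancel, rule Lim_null_comparison)
  show "\<forall>\<^sub>F n in sequentially. norm (ip (s n) y - ip x y) \<le> nm (s n - x) * nm y"
    using Cauchy_Schwarz[of "s _ - x" y] s x y by (simp add: ip_diff_left)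
  show "(\<lambda>n. nm (s n - x) * nm y) \<longlonglongrightarrow> 0"
    using tendsto_mult_left_zero[OF lim] .
qed

lemma nm_tendsto:
  assumes s: "\<And>n. s n \<in> S" and x: "x \<in> S" and lim: "(\<lambda>n. nm (s n - x)) \<longlonglongrightarrow> 0"
  shows "(\<lambda>n. nm (s n)) \<longlonglongrightarrow> nm x"
proof (rule LIM_zero_cancel, rule Lim_null_comparison[OF _ lim])
  show "\<forall>\<^sub>F n in sequentially. norm (nm (s n) - nm x) \<le> nm (s n - x)"
    using abs_diff s x by simp
qed

text \<open>The bound on \<open>nm y\<close> makes the functional 1-Lipschitz; it covers the
  coefficient functionals, where \<open>y\<close> is a unit vector.\<close>

lemma ip_cont_fun:
  assumes "y \<in> S" "nm y \<le> 1"
  shows "cont_fun S {nm} (\<lambda>x. ip x y)"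
proof (rule lipschitz_cont_fun)
  fix x z assume "x \<in> S" "z \<in> S"
  then show "dist (ip x y) (ip z y) \<le> nm (x - z)"
    using Cauchy_Schwarz[of "x - z" y] mult_left_mono[of "nm y" 1 "nm (x - z)"] assms
    by (simp add: dist_norm ip_diff_left)
qed

end

subsection \<open>Orthonormal sequences and bases\<close>

locale orthonormal_seq = cinner +
  fixes e :: "nat \<Rightarrow> 'a"
  assumes e_mem [simp]: "e n \<in> S" and ortho: "ip (e i) (e j) = (if i = j then 1 else 0)"
begin

lemma nm_e [simp]: "nm (e n) = 1"
  by (simp add: ipnorm_def ortho)

lemma comb_mem [simp]: "(\<Sum>i\<in>I. a i *\<^sub>C e i) \<in> S"
  by (intro sum_mem mem) simp

lemma ip_comb:
  assumes "finite I"
  shows "ip (\<Sum>i\<in>I. a i *\<^sub>C e i) (e j) = (if j \<in> I then a j else 0)"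
proof -
  have "ip (\<Sum>i\<in>I. a i *\<^sub>C e i) (e j) = (\<Sum>i\<in>I. ip (a i *\<^sub>C e i) (e j))"
    using assms by (intro ip_sum_left) auto
  also have "\<dots> = (\<Sum>i\<in>I. if i = j then a i else 0)"
    by (intro sum.cong) (auto simp: ip_scale_left ortho)
  finally show ?thesis using assms by simp
qed

lemma ip_comb_right:
  assumes "finite I" "x \<in> S"
  shows "ip x (\<Sum>i\<in>I. a i *\<^sub>C e i) = (\<Sum>i\<in>I. cnj (a i) * ip x (e i))"
proof -
  have "ip x (\<Sum>i\<in>I. a i *\<^sub>C e i) = cnj (\<Sum>i\<in>I. a i * ip (e i) x)"
    using assms ip_cnj[of "\<Sum>i\<in>I. a i *\<^sub>C e i" x] by (simp add: ip_sum_left ip_scale_left)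
  also have "\<dots> = (\<Sum>i\<in>I. cnj (a i) * ip x (e i))"
    using assms ip_cnj[of "e _" x] by simp
  finally show ?thesis .
qed

lemma nm_comb:
  assumes "finite I"
  shows "(nm (\<Sum>i\<in>I. a i *\<^sub>C e i))\<^sup>2 = (\<Sum>i\<in>I. (cmod (a i))\<^sup>2)"
proof -
  have "ip (\<Sum>i\<in>I. a i *\<^sub>C e i) (\<Sum>i\<in>I. a i *\<^sub>C e i) = (\<Sum>i\<in>I. of_real ((cmod (a i))\<^sup>2))"
    using assms by (subst ip_comb_right) (auto simp: ip_comb mult.commute simp flip: complex_norm_square intro!: sum.cong)
  then show ?thesis by (simp add: nm_power2)
qed

text \<open>The residual of the Fourier sum is orthogonal to every \<open>e i\<close> with
  \<open>i\<close> in \<open>I\<close>, so Pythagoras shows that any other choice of coefficients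
  can only increase the distance.\<close>

lemma projection_nearest:
  assumes x: "x \<in> S" and I: "finite I"
  shows "nm (x - (\<Sum>i\<in>I. ip x (e i) *\<^sub>C e i)) \<le> nm (x - (\<Sum>i\<in>I. c i *\<^sub>C e i))"
proof -
  define r where "r = x - (\<Sum>i\<in>I. ip x (e i) *\<^sub>C e i)"
  define d where "d = (\<Sum>i\<in>I. (ip x (e i) - c i) *\<^sub>C e i)"
  have r: "r \<in> S" and d: "d \<in> S" using x by (auto simp: r_def d_def)
  have "ip r (e i) = 0" if "i \<in> I" for i
    using that x I by (simp add: r_def ip_diff_left ip_comb)
  then have "ip r d = 0"
    using I r by (simp add: d_def ip_comb_right)
  then have "(nm (r + d))\<^sup>2 = (nm r)\<^sup>2 + (nm d)\<^sup>2"
    using nm_add_power2[OF r d] by simp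
  moreover have "r + d = x - (\<Sum>i\<in>I. c i *\<^sub>C e i)"
    by (simp add: r_def d_def cvec.scale_left_diff_distrib sum_subtractf)
  ultimately have "(nm r)\<^sup>2 \<le> (nm (x - (\<Sum>i\<in>I. c i *\<^sub>C e i)))\<^sup>2" by simp
  then show ?thesis unfolding r_def by (rule power2_le_imp_le) (use x in auto)
qed

end

locale orthonormal_basis = orthonormal_seq +
  assumes dense: "sn_dense S {ipnorm ip} (cspan_seq e)"
begin

text \<open>Density provides some combination \<open>y\<close> of length \<open>m\<close> near
  \<open>x\<close>. For every \<open>n \<ge> m\<close> the padded \<open>y\<close> competes with the
  \<open>n\<close>-th Fourier sum, which is at least as close to \<open>x\<close>.\<close>

lemma expansion:
  assumes x: "x \<in> S"
  shows "(\<lambda>n. nm ((\<Sum>i<n. ip x (e i) *\<^sub>C e i) - x)) \<longlonglongrightarrow> 0"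
proof (rule LIMSEQ_I)
  fix d :: real assume d: "d > 0"
  obtain y where y: "y \<in> cspan_seq e" "nm (y - x) < d" using denseD[OF dense x d] .
  then obtain m c where yc: "y = (\<Sum>i<m. c i *\<^sub>C e i)" unfolding cspan_seq_def by blast
  have "norm (nm ((\<Sum>i<n. ip x (e i) *\<^sub>C e i) - x) - 0) < d" if "m \<le> n" for n
  proof -
    have "y = (\<Sum>i<n. (if i < m then c i else 0) *\<^sub>C e i)"
      unfolding yc using that by (intro sum.mono_neutral_cong_left) auto
    then have "nm (x - (\<Sum>i<n. ip x (e i) *\<^sub>C e i)) \<le> nm (x - y)"
      using projection_nearest[OF x, of "{..<n}" "\<lambda>i. if i < m then c i else 0"] by simp
    then show ?thesis
      using y(2) x diff_commute[of x y] diff_commute[of x "\<Sum>i<n. ip x (e i) *\<^sub>C e i"] yc by simp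
  qed
  then show "\<exists>no. \<forall>n\<ge>no. norm (nm ((\<Sum>i<n. ip x (e i) *\<^sub>C e i) - x) - 0) < d" by blast
qed

lemma Parseval:
  assumes x: "x \<in> S"
  shows "(\<lambda>i. (cmod (ip x (e i)))\<^sup>2) sums (nm x)\<^sup>2"
  using tendsto_power[OF nm_tendsto[OF _ x expansion[OF x]], of 2]
  by (simp add: sums_def nm_comb)

text \<open>By Parseval the difference has norm zero. This is the tool for checking identities
  between vectors one coefficient at a time.\<close>

lemma coeff_eqI:
  assumes "x \<in> S" "y \<in> S" "\<And>i. ip x (e i) = ip y (e i)"
  shows "x = y"
proof -
  have "(\<lambda>i. 0) sums (nm (x - y))\<^sup>2"
    using Parseval[of "x - y"] assms by (simp add: ip_diff_left)
  then have "nm (x - y) = 0" using sums_unique2[OF sums_zero] by fastforce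
  then show ?thesis using nm_eq_0_imp[of "x - y"] assms by simp
qed

end

locale hilbert_basis = orthonormal_basis +
  assumes complete: "ip_complete S ip"
begin

text \<open>Squared distances of partial sums are blocks of the convergent series, so the partial
  sums are Cauchy; completeness of \<open>S\<close> yields the vector.\<close>

lemma Riesz_Fischer:
  assumes a: "summable (\<lambda>i. (cmod (a i))\<^sup>2)"
  shows "\<exists>x\<in>S. \<forall>i. ip x (e i) = a i"
proof -
  define s where "s n = (\<Sum>i<n. a i *\<^sub>C e i)" for n
  have s: "s n \<in> S" for n by (simp add: s_def)
  have diff: "(nm (s n - s m))\<^sup>2 = (\<Sum>i=m..<n. (cmod (a i))\<^sup>2)" if "m \<le> n" for m n
    using that by (simp add: s_def lessThan_atLeast0 sum_diff_nat_ivl nm_comb flip: nm_comb)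
  have "\<exists>N. \<forall>m\<ge>N. \<forall>n\<ge>N. nm (s m - s n) < d" if d: "d > 0" for d
  proof -
    obtain N where N: "norm (\<Sum>i=m..<n. (cmod (a i))\<^sup>2) < d\<^sup>2" if "m \<ge> N" for m n
      using a d unfolding summable_Cauchy by (metis zero_less_power)
    have le: "nm (s n - s m) < d" if "N \<le> m" "m \<le> n" for m n
    proof (rule power_less_imp_less_base)
      show "(nm (s n - s m))\<^sup>2 < d\<^sup>2" using N[of m n] that diff by simp
    qed (use d in simp)
    have "nm (s m - s n) < d" if "N \<le> m" "N \<le> n" for m n
      using le[of m n] le[of n m] that diff_commute[of "s m" "s n"] s by (cases "m \<le> n") auto
    then show ?thesis by blast
  qed
  then obtain x where x: "x \<in> S" "(\<lambda>n. nm (s n - x)) \<longlonglongrightarrow> 0"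
    using complete s unfolding ip_complete_def by blast
  have "ip x (e i) = a i" for i
  proof (rule LIMSEQ_unique)
    show "(\<lambda>n. ip (s n) (e i)) \<longlonglongrightarrow> ip x (e i)" using x s by (intro ip_tendsto_left) auto
    \<comment> \<open>From \<open>n = i + 1\<close> on, the sum contains the \<open>i\<close>-th
      term and its coefficient no longer changes.\<close>
    have "\<forall>\<^sub>F n in sequentially. ip (s n) (e i) = a i"
      using eventually_gt_at_top[of i] by eventually_elim (simp add: s_def ip_comb)
    then show "(\<lambda>n. ip (s n) (e i)) \<longlonglongrightarrow> a i" by (rule tendsto_eventually)
  qed
  with x show ?thesis by blast
qed

end

lemma hilbert_basisI:
  assumes "csubspace S" "inner_on S ip" "ip_complete S ip" "onb_on S ip e"
  shows "hilbert_basis S ip e"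
  using assms by unfold_locales (auto simp: onb_on_def)

text \<open>Both spaces are identified with the square-summable sequences: Parseval makes the
  coefficients of \<open>x\<close> summable, Riesz-Fischer realises them in \<open>S'\<close>.
  Exchanging the roles of the spaces gives surjectivity.\<close>

lemma onb_isometry:
  assumes "hilbert_basis S ip e" and "hilbert_basis S' ip' e'"
  obtains T where "clinear_on S T" "bij_betw T S S'" "\<And>x. x \<in> S \<Longrightarrow> ipnorm ip' (T x) = ipnorm ip x"
    "\<And>n. T (e n) = e' n"
proof -
  interpret A: hilbert_basis S ip e by fact
  interpret B: hilbert_basis S' ip' e' by fact
  have "\<exists>y\<in>S'. \<forall>i. ip' y (e' i) = ip x (e i)" if "x \<in> S" for x
    using B.Riesz_Fischer A.Parseval[OF that] by (simp add: sums_iff)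
  then obtain T where T: "x \<in> S \<Longrightarrow> T x \<in> S'" "x \<in> S \<Longrightarrow> ip' (T x) (e' i) = ip x (e i)" for x i
    by metis
  have "clinear_on S T" unfolding clinear_on_def
    by (auto intro!: B.coeff_eqI simp: T A.ip_add_left B.ip_add_left A.ip_scale_left B.ip_scale_left)
  moreover have "bij_betw T S S'"
  proof (rule bij_betwI')
    show "T x = T y \<longleftrightarrow> x = y" if "x \<in> S" "y \<in> S" for x y
      using A.coeff_eqI[OF that] T(2) that by metis
    show "\<exists>x\<in>S. y = T x" if "y \<in> S'" for y
    proof -
      obtain x where x: "x \<in> S" "\<And>i. ip x (e i) = ip' y (e' i)"
        using A.Riesz_Fischer[of "\<lambda>i. ip' y (e' i)"] B.Parseval[of y] \<open>y \<in> S'\<close>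
        by (auto simp: sums_iff)
      then have "y = T x" using \<open>y \<in> S'\<close> T by (intro B.coeff_eqI) auto
      with x show ?thesis by blast
    qed
  qed (rule T)
  moreover have "ipnorm ip' (T x) = ipnorm ip x" if "x \<in> S" for x
  proof -
    have "(ipnorm ip' (T x))\<^sup>2 = (ipnorm ip x)\<^sup>2"
      using A.Parseval[OF that] B.Parseval[OF T(1)[OF that]] T(2)[OF that] by (simp add: sums_iff)
    then show ?thesis using T(1) that by (simp add: power2_eq_iff_nonneg)
  qed
  moreover have "T (e n) = e' n" for n
    by (intro B.coeff_eqI) (auto simp: T A.ortho B.ortho)
  ultimately show thesis by (rule that)
qed

subsection \<open>Gram-Schmidt orthonormalisation\<close>

fun gram_schmidt :: "('a::cvector \<Rightarrow> 'a \<Rightarrow> complex) \<Rightarrow> (nat \<Rightarrow> 'a) \<Rightarrow> nat \<Rightarrow> 'a" where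
  "gram_schmidt ip u n =
    (let v = u n - (\<Sum>i<n. ip (u n) (gram_schmidt ip u i) *\<^sub>C gram_schmidt ip u i)
     in complex_of_real (1 / ipnorm ip v) *\<^sub>C v)"

declare gram_schmidt.simps [simp del]

text \<open>Independence of \<open>u\<close> guarantees that the vectors to be normalised are
  nonzero. Only the inclusion of spans needed to transfer density from \<open>u\<close> to the new
  sequence is recorded.\<close>

lemma (in cinner) gram_schmidt_orthonormal:
  assumes u: "\<And>n. u n \<in> S" and indep: "\<And>n. u n \<notin> cvec.span (u ` {..<n})"
  shows "orthonormal_seq S ip (gram_schmidt ip u)"
    and "cvec.span (range u) \<subseteq> cvec.span (range (gram_schmidt ip u))"
proof -
  define e where "e = gram_schmidt ip u"
  define v where "v n = u n - (\<Sum>i<n. ip (u n) (e i) *\<^sub>C e i)" for n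
  have e: "e n = complex_of_real (1 / nm (v n)) *\<^sub>C v n" for n
    unfolding e_def v_def by (subst gram_schmidt.simps) (simp add: Let_def)
  \<comment> \<open>Membership of \<open>e n\<close> in the span of \<open>u 0, ..., u n\<close>
    belongs to the induction: it places the subtracted sum in the span of the earlier
    \<open>u i\<close>, so that independence forces \<open>v n\<close> to be nonzero.\<close>
  have main: "e n \<in> S \<and> e n \<in> cvec.span (u ` {..n}) \<and> nm (v n) \<noteq> 0 \<and> v n \<in> S \<and> nm (e n) = 1
     \<and> (\<forall>i<n. ip (e n) (e i) = 0)" for n
  proof (induction n rule: less_induct)
    case (less n)
    have vS: "v n \<in> S" unfolding v_def using u less by (intro mem sum_mem) auto
    have "cvec.span (u ` {..i}) \<subseteq> cvec.span (u ` {..<n})" if "i < n" for i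
      using that by (intro cvec.span_mono) auto
    then have P: "(\<Sum>i<n. ip (u n) (e i) *\<^sub>C e i) \<in> cvec.span (u ` {..<n})"
      using less by (intro cvec.span_sum cvec.span_scale) blast
    have "v n \<noteq> 0" using indep[of n] P unfolding v_def by auto
    then have nv: "nm (v n) \<noteq> 0" using nm_eq_0_imp vS by blast
    have "cvec.span (u ` {..<n}) \<subseteq> cvec.span (u ` {..n})"
      by (intro cvec.span_mono image_mono) auto
    moreover have "u n \<in> cvec.span (u ` {..n})" by (intro cvec.span_base) simp
    ultimately have "v n \<in> cvec.span (u ` {..n})"
      unfolding v_def using P by (intro cvec.span_diff) auto
    then have eu: "e n \<in> cvec.span (u ` {..n})" unfolding e by (rule cvec.span_scale)
    have ne: "nm (e n) = 1" unfolding e using vS nv by (simp add: nm_scale norm_divide)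
    have "ip (v n) (e i) = 0" if i: "i < n" for i
    proof -
      have ort: "ip (e j) (e i) = (if j = i then 1 else 0)" if "j < n" for j
        using less[OF that] less[OF i] ip_self[of "e i"] ip_cnj[of "e i" "e j"]
        by (cases j i rule: linorder_cases) auto
      have "ip (\<Sum>j<n. ip (u n) (e j) *\<^sub>C e j) (e i) = (\<Sum>j<n. ip (ip (u n) (e j) *\<^sub>C e j) (e i))"
        using less i by (intro ip_sum_left) auto
      also have "\<dots> = (\<Sum>j<n. if j = i then ip (u n) (e j) else 0)"
        using less i by (intro sum.cong) (auto simp: ip_scale_left ort)
      also have "\<dots> = ip (u n) (e i)" using i by simp
      finally show ?thesis
        unfolding v_def using u less i by (subst ip_diff_left) (auto intro!: sum_mem)
    qed
    then have "\<forall>i<n. ip (e n) (e i) = 0" unfolding e[of n] using vS less by (simp add: ip_scale_left)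
    with vS nv eu ne show ?case by (simp add: e[of n])
  qed
  show "orthonormal_seq S ip (gram_schmidt ip u)"
    unfolding e_def[symmetric]
  proof unfold_locales
    show "e n \<in> S" for n using main by blast
    show "ip (e i) (e j) = (if i = j then 1 else 0)" for i j
      using main[of i] main[of j] ip_self[of "e i"] ip_cnj[of "e i" "e j"] ip_cnj[of "e j" "e i"]
      by (cases i j rule: linorder_cases) auto
  qed
  have "u n \<in> cvec.span (range e)" for n
  proof -
    have "u n = complex_of_real (nm (v n)) *\<^sub>C e n + (\<Sum>i<n. ip (u n) (e i) *\<^sub>C e i)"
      using main[of n] by (simp add: e[of n] scaleC_scaleC scaleC_one) (simp add: v_def)
    then show ?thesis
      by (metis (no_types, lifting) cvec.span_add cvec.span_base cvec.span_scale cvec.span_sum rangeI)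
  qed
  then show "cvec.span (range u) \<subseteq> cvec.span (range (gram_schmidt ip u))"
    unfolding e_def[symmetric] by (intro cvec.span_minimal) auto
qed

subsection \<open>Extension of an inner product by continuity\<close>

text \<open>Approximate \<open>x\<close> and \<open>y\<close> by sequences in \<open>E\<close> and
  take the limit of the values of \<open>B\<close> in the scalars. The inequality \<open>le\<close>
  makes \<open>B\<close> continuous for \<open>p\<close>, while \<open>ge\<close> survives the limit
  and keeps the extension definite.\<close>

lemma (in seminormed) inner_product_extension:
  assumes E: "csubspace E" "E \<subseteq> S" and dense: "\<And>x d. x \<in> S \<Longrightarrow> d > 0 \<Longrightarrow> \<exists>u\<in>E. p (u - x) < d"
    and B: "inner_on E B" and le: "\<And>u. u \<in> E \<Longrightarrow> ipnorm B u \<le> p u"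
    and ge: "\<And>u. u \<in> E \<Longrightarrow> p u \<le> K * ipnorm B u"
    and definite: "\<And>x. x \<in> S \<Longrightarrow> p x = 0 \<Longrightarrow> x = 0"
  obtains ip where "inner_on S ip" "\<And>u v. u \<in> E \<Longrightarrow> v \<in> E \<Longrightarrow> ip u v = B u v"
    "\<And>x. x \<in> S \<Longrightarrow> ipnorm ip x \<le> p x" "\<And>x. x \<in> S \<Longrightarrow> p x \<le> K * ipnorm ip x"
proof -
  interpret E: cinner E B using E B by unfold_locales
  \<comment> \<open>\<open>app u x\<close> says that \<open>u\<close> is a sequence in
    \<open>E\<close> converging to \<open>x\<close> with respect to \<open>p\<close>.\<close>
  define app where "app u x \<longleftrightarrow> (\<forall>n. u n \<in> E) \<and> (\<lambda>n. p (u n - x)) \<longlonglongrightarrow> 0" for u :: "nat \<Rightarrow> 'a" and x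
  have ES: "u \<in> E \<Longrightarrow> u \<in> S" for u using E by auto
  have app_ex: "\<exists>u. app u x" if x: "x \<in> S" for x
  proof -
    have "\<exists>u\<in>E. p (u - x) < inverse (real (Suc n))" for n using dense[OF x] by simp
    then obtain u where u: "\<And>n. u n \<in> E" "\<And>n. p (u n - x) < inverse (real (Suc n))" by metis
    have "(\<lambda>n. p (u n - x)) \<longlonglongrightarrow> 0"
    proof (rule Lim_null_comparison[OF _ LIMSEQ_inverse_real_of_nat])
      show "\<forall>\<^sub>F n in sequentially. norm (p (u n - x)) \<le> inverse (real (Suc n))"
        using u x ES by (intro always_eventually) (simp add: less_imp_le)
    qed
    with u show ?thesis by (auto simp: app_def)
  qed
  have app_const: "app (\<lambda>_. u) u" if "u \<in> E" for u using that by (simp add: app_def)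
  have app_add: "app (\<lambda>n. u n + v n) (x + y)" if "app u x" "app v y" "x \<in> S" "y \<in> S" for u v x y
    unfolding app_def
  proof (intro conjI allI)
    show "u n + v n \<in> E" for n using that by (auto simp: app_def)
    show "(\<lambda>n. p (u n + v n - (x + y))) \<longlonglongrightarrow> 0"
    proof (rule Lim_null_comparison)
      show "\<forall>\<^sub>F n in sequentially. norm (p (u n + v n - (x + y))) \<le> p (u n - x) + p (v n - y)"
      proof (intro always_eventually allI)
        fix n have m: "u n \<in> S" "v n \<in> S" using that ES by (auto simp: app_def)
        have "u n + v n - (x + y) = (u n - x) + (v n - y)" by simp
        with triangle[of "u n - x" "v n - y"] show "norm (p (u n + v n - (x + y))) \<le> p (u n - x) + p (v n - y)"
          using nonneg[of "u n + v n - (x + y)"] m that(3,4) by (metis abs_of_nonneg mem(2,3) real_norm_def)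
      qed
      show "(\<lambda>n. p (u n - x) + p (v n - y)) \<longlonglongrightarrow> 0"
        using that tendsto_add[of "\<lambda>n. p (u n - x)" 0 _ "\<lambda>n. p (v n - y)" 0] by (simp add: app_def)
    qed
  qed
  have app_scale: "app (\<lambda>n. c *\<^sub>C u n) (c *\<^sub>C x)" if "app u x" "x \<in> S" for u x c
    unfolding app_def
  proof (intro conjI allI)
    show "c *\<^sub>C u n \<in> E" for n using that by (auto simp: app_def)
    have "p (c *\<^sub>C u n - c *\<^sub>C x) = cmod c * p (u n - x)" for n
      using that ES scale[of "u n - x" c] by (simp add: app_def cvec.scale_right_diff_distrib)
    then show "(\<lambda>n. p (c *\<^sub>C u n - c *\<^sub>C x)) \<longlonglongrightarrow> 0"
      using that tendsto_mult_right_zero[of "\<lambda>n. p (u n - x)"] by (simp add: app_def)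
  qed
  have app_norm: "(\<lambda>n. p (u n)) \<longlonglongrightarrow> p x" if "app u x" "x \<in> S" for u x
  proof (rule LIM_zero_cancel, rule Lim_null_comparison)
    show "\<forall>\<^sub>F n in sequentially. norm (p (u n) - p x) \<le> p (u n - x)"
      using that ES abs_diff[of "u _" x] by (intro always_eventually) (simp add: app_def)
  qed (use that in \<open>simp add: app_def\<close>)
  have CS: "cmod (B u v) \<le> p u * p v" if "u \<in> E" "v \<in> E" for u v
    using E.Cauchy_Schwarz[OF that] le[OF that(1)] le[OF that(2)] E.nonneg that ES
    by (meson mult_mono nonneg order_trans)
  \<comment> \<open>Split the difference as \<open>B (u - u') v + B u' (v - v')\<close> and measure
    both gaps through \<open>x\<close> and \<open>y\<close>. The estimate serves twice: for the
    Cauchy property and for independence of the approximating sequences.\<close>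
  have diff: "cmod (B u v - B u' v') \<le> (p (u - x) + p (u' - x)) * p v + p u' * (p (v - y) + p (v' - y))"
    if "u \<in> E" "u' \<in> E" "v \<in> E" "v' \<in> E" "x \<in> S" "y \<in> S" for u u' v v' x y
  proof -
    have "B u v - B u' v' = B (u - u') v + B u' (v - v')"
      using that by (simp add: E.ip_diff_left E.ip_diff_right)
    then have "cmod (B u v - B u' v') \<le> p (u - u') * p v + p u' * p (v - v')"
      using norm_triangle_ineq[of "B (u - u') v" "B u' (v - v')"] CS[of "u - u'" v] CS[of u' "v - v'"] that
      by simp
    moreover have "p (u - u') \<le> p (u - x) + p (u' - x)" "p (v - v') \<le> p (v - y) + p (v' - y)"
      using triangle_mid[of u x u'] triangle_mid[of v y v'] diff_commute[of x u'] diff_commute[of y v']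
        that ES by auto
    ultimately show ?thesis
      using mult_right_mono[of "p (u - u')" "p (u - x) + p (u' - x)" "p v"]
        mult_left_mono[of "p (v - v')" "p (v - y) + p (v' - y)" "p u'"] nonneg[of v] nonneg[of u'] that ES
      by (smt (verit))
  qed
  \<comment> \<open>The limit is quantified before the sequences, so a choice of \<open>l\<close>
    for each pair \<open>x\<close>, \<open>y\<close> is automatically well defined.\<close>
  have "\<exists>l. \<forall>u v. app u x \<longrightarrow> app v y \<longrightarrow> (\<lambda>n. B (u n) (v n)) \<longlonglongrightarrow> l" if x: "x \<in> S" and y: "y \<in> S" for x y
  proof -
    obtain s t where s: "app s x" and t: "app t y" using app_ex x y by metis
    have "Cauchy (\<lambda>n. B (s n) (t n))"
    proof (rule metric_CauchyI)
      fix d :: real assume d: "d > 0"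
      \<comment> \<open>\<open>M\<close> is the sum of the eventual bounds \<open>p x + 1\<close>
        and \<open>p y + 1\<close> on the approximants; \<open>r\<close> is chosen so that
        \<open>2 * r * M = d\<close>.\<close>
      define M where "M = p x + p y + 2"
      have M: "M > 0" unfolding M_def using nonneg[OF x] nonneg[OF y] by linarith
      define r where "r = d / (2 * M)"
      have r: "r > 0" using d M by (simp add: r_def)
      have "\<forall>\<^sub>F n in sequentially. p (s n - x) < r \<and> p (t n - y) < r \<and> p (s n) < p x + 1 \<and> p (t n) < p y + 1"
        using s t r app_norm[OF s x] app_norm[OF t y]
        by (intro eventually_conj order_tendstoD(2)) (auto simp: app_def)
      then obtain N where N: "\<And>n. n \<ge> N \<Longrightarrow> p (s n - x) < r \<and> p (t n - y) < r \<and> p (s n) < p x + 1 \<and> p (t n) < p y + 1"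
        unfolding eventually_sequentially by blast
      have "dist (B (s m) (t m)) (B (s n) (t n)) < d" if "N \<le> m" "N \<le> n" for m n
      proof -
        have mem: "s m \<in> E" "s n \<in> E" "t m \<in> E" "t n \<in> E" using s t by (auto simp: app_def)
        have "cmod (B (s m) (t m) - B (s n) (t n))
          \<le> (p (s m - x) + p (s n - x)) * p (t m) + p (s n) * (p (t m - y) + p (t n - y))"
          using diff mem x y by blast
        also have "\<dots> \<le> (2 * r) * p (t m) + p (s n) * (2 * r)"
          using N[OF that(1)] N[OF that(2)] mem ES r x y by (intro add_mono mult_mono) auto
        also have "\<dots> < (2 * r) * (p y + 1) + (p x + 1) * (2 * r)"
          using N[OF that(1)] N[OF that(2)] r
          by (intro add_strict_mono mult_strict_left_mono mult_strict_right_mono) auto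
        also have "\<dots> = 2 * r * M" by (simp add: M_def algebra_simps)
        also have "\<dots> = d" using M by (simp add: r_def)
        finally show ?thesis by (simp add: dist_norm)
      qed
      then show "\<exists>N. \<forall>m\<ge>N. \<forall>n\<ge>N. dist (B (s m) (t m)) (B (s n) (t n)) < d" by blast
    qed
    then obtain l where l: "(\<lambda>n. B (s n) (t n)) \<longlonglongrightarrow> l" using Cauchy_convergent convergent_def by blast
    have "(\<lambda>n. B (u n) (v n)) \<longlonglongrightarrow> l" if u: "app u x" and v: "app v y" for u v
    proof (rule LIM_zero_cancel, rule Lim_null_comparison)
      have mem: "u n \<in> E" "v n \<in> E" "s n \<in> E" "t n \<in> E" for n using u v s t by (auto simp: app_def)
      show "\<forall>\<^sub>F n in sequentially. norm (B (u n) (v n) - l) \<le> (p (u n - x) + p (s n - x)) * p (v n)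
          + p (s n) * (p (v n - y) + p (t n - y)) + norm (B (s n) (t n) - l)"
      proof (intro always_eventually allI)
        fix n
        have "norm (B (u n) (v n) - l) \<le> norm (B (u n) (v n) - B (s n) (t n)) + norm (B (s n) (t n) - l)"
          using norm_triangle_ineq[of "B (u n) (v n) - B (s n) (t n)" "B (s n) (t n) - l"] by simp
        then show "norm (B (u n) (v n) - l) \<le> (p (u n - x) + p (s n - x)) * p (v n)
          + p (s n) * (p (v n - y) + p (t n - y)) + norm (B (s n) (t n) - l)"
          using diff[OF mem(1,3,2,4)[of n] x y] by linarith
      qed
      have "(\<lambda>n. (p (u n - x) + p (s n - x)) * p (v n) + p (s n) * (p (v n - y) + p (t n - y))
          + norm (B (s n) (t n) - l)) \<longlonglongrightarrow> (0 + 0) * p y + p x * (0 + 0) + norm (l - l)"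
        using u v s t l app_norm[OF v y] app_norm[OF s x] by (intro tendsto_intros) (simp_all add: app_def)
      then show "(\<lambda>n. (p (u n - x) + p (s n - x)) * p (v n) + p (s n) * (p (v n - y) + p (t n - y))
          + norm (B (s n) (t n) - l)) \<longlonglongrightarrow> 0" by simp
    qed
    then show ?thesis by blast
  qed
  then obtain ip where ip: "(\<lambda>n. B (u n) (v n)) \<longlonglongrightarrow> ip x y"
    if "x \<in> S" "y \<in> S" "app u x" "app v y" for x y u v
    by metis
  have ext: "ip u v = B u v" if "u \<in> E" "v \<in> E" for u v
    using LIMSEQ_unique[OF ip[OF _ _ app_const app_const] tendsto_const] that ES by blast
  have norm_lim: "(\<lambda>n. ipnorm B (u n)) \<longlonglongrightarrow> ipnorm ip x" if "app u x" "x \<in> S" for u x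
    unfolding ipnorm_def using ip[OF that(2,2,1,1)] by (intro tendsto_intros)
  have norm_le: "ipnorm ip x \<le> p x" if x: "x \<in> S" for x
  proof -
    obtain u where u: "app u x" using app_ex x by blast
    then show ?thesis
      using le by (intro LIMSEQ_le[OF norm_lim[OF u x] app_norm[OF u x]]) (auto simp: app_def)
  qed
  have norm_ge: "p x \<le> K * ipnorm ip x" if x: "x \<in> S" for x
  proof -
    obtain u where u: "app u x" using app_ex x by blast
    then show ?thesis
      using ge by (intro LIMSEQ_le[OF app_norm[OF u x] tendsto_mult_left[OF norm_lim[OF u x]]]) (auto simp: app_def)
  qed
  have "inner_on S ip"
    unfolding inner_on_def
  proof (intro conjI ballI allI impI)
    fix x y assume x: "x \<in> S" and y: "y \<in> S"
    obtain u v where u: "app u x" and v: "app v y" using app_ex x y by metis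
    then have mem: "u n \<in> E" "v n \<in> E" for n by (auto simp: app_def)
    show "ip (x + y) z = ip x z + ip y z" if z: "z \<in> S" for z
    proof -
      obtain w where w: "app w z" using app_ex z by blast
      then have "B (u n + v n) (w n) = B (u n) (w n) + B (v n) (w n)" for n
        using mem by (simp add: E.ip_add_left app_def)
      moreover have "(\<lambda>n. B (u n + v n) (w n)) \<longlonglongrightarrow> ip (x + y) z"
        using ip[of "x + y" z, OF _ z app_add[OF u v x y] w] x y by blast
      moreover have "(\<lambda>n. B (u n) (w n) + B (v n) (w n)) \<longlonglongrightarrow> ip x z + ip y z"
        using ip x y z u v w by (intro tendsto_add) auto
      ultimately show ?thesis using LIMSEQ_unique by simp
    qed
    show "ip (c *\<^sub>C x) y = c * ip x y" for c
    proof -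
      have "(\<lambda>n. B (c *\<^sub>C u n) (v n)) \<longlonglongrightarrow> ip (c *\<^sub>C x) y"
        using ip[of "c *\<^sub>C x" y, OF _ y app_scale[OF u x] v] x by blast
      moreover have "B (c *\<^sub>C u n) (v n) = c * B (u n) (v n)" for n using mem by (simp add: E.ip_scale_left)
      moreover have "(\<lambda>n. c * B (u n) (v n)) \<longlonglongrightarrow> c * ip x y"
        using ip x y u v by (intro tendsto_intros) auto
      ultimately show ?thesis using LIMSEQ_unique by simp
    qed
    show "ip y x = cnj (ip x y)"
    proof (rule LIMSEQ_unique)
      show "(\<lambda>n. B (v n) (u n)) \<longlonglongrightarrow> ip y x" using ip x y u v by blast
      have "(\<lambda>n. cnj (B (u n) (v n))) \<longlonglongrightarrow> cnj (ip x y)" using ip x y u v by (intro tendsto_intros) auto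
      moreover have "B (v n) (u n) = cnj (B (u n) (v n))" for n using E.ip_cnj mem by blast
      ultimately show "(\<lambda>n. B (v n) (u n)) \<longlonglongrightarrow> cnj (ip x y)" by simp
    qed
  next
    fix x assume x: "x \<in> S"
    obtain u where u: "app u x" using app_ex x by blast
    have "(\<lambda>n. Re (B (u n) (u n))) \<longlonglongrightarrow> Re (ip x x)" using ip[OF x x u u] by (intro tendsto_intros)
    then show "0 \<le> Re (ip x x)"
      by (rule LIMSEQ_le_const) (use u E.ip_self_nonneg in \<open>auto simp: app_def\<close>)
    \<comment> \<open>The lower estimate \<open>norm_ge\<close> forces \<open>p x = 0\<close>, and
      \<open>p\<close> is definite on \<open>S\<close>.\<close>
    show "x = 0" if "ip x x = 0"
      using norm_ge[OF x] that definite[OF x] nonneg[OF x] by (simp add: ipnorm_def)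
  qed
  from that[OF this ext norm_le norm_ge] show thesis .
qed

text \<open>The inner product of the space of finite sequences, transported to the span.
  Independence makes the coefficients of a vector unique up to padding by zeros.\<close>

lemma coefficient_inner_product:
  fixes \<xi> :: "nat \<Rightarrow> 'a::cvector"
  assumes indep: "\<And>n c. (\<Sum>i<n. c i *\<^sub>C \<xi> i) = 0 \<Longrightarrow> \<forall>i<n. c i = 0"
  obtains B where "inner_on (cspan_seq \<xi>) B"
    "\<And>n c d. B (\<Sum>i<n. c i *\<^sub>C \<xi> i) (\<Sum>i<n. d i *\<^sub>C \<xi> i) = (\<Sum>i<n. c i * cnj (d i))"
proof -
  \<comment> \<open>Two vectors of the span may come with sums of different length. \<open>R\<close>
    asks for a common length, and \<open>pad\<close> below compares different lengths, so that
    \<open>R\<close> has exactly one value.\<close>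
  define R where "R x y z \<longleftrightarrow> (\<exists>n c d. x = (\<Sum>i<n. c i *\<^sub>C \<xi> i) \<and> y = (\<Sum>i<n. d i *\<^sub>C \<xi> i) \<and>
    z = (\<Sum>i<n. c i * cnj (d i)))" for x y z
  define B where "B x y = (THE z. R x y z)" for x y
  define pad where "pad n c = (\<lambda>i. if i < n then c i else 0)" for n :: nat and c :: "nat \<Rightarrow> complex"
  have pad: "(\<Sum>i<n. c i *\<^sub>C \<xi> i) = (\<Sum>i<N. pad n c i *\<^sub>C \<xi> i)" if "n \<le> N" for n N c
    unfolding pad_def using that by (intro sum.mono_neutral_cong_left) auto
  have pad2: "(\<Sum>i<n. c i * cnj (d i)) = (\<Sum>i<N. pad n c i * cnj (pad n d i))" if "n \<le> N" for n N c d
    unfolding pad_def using that by (intro sum.mono_neutral_cong_left) auto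
  have uniq: "c i = d i" if "(\<Sum>i<n. c i *\<^sub>C \<xi> i) = (\<Sum>i<n. d i *\<^sub>C \<xi> i)" "i < n" for n i and c d :: "nat \<Rightarrow> complex"
    using indep[where n = n and c = "\<lambda>i. c i - d i"] that by (simp add: cvec.scale_left_diff_distrib sum_subtractf)
  have B: "B (\<Sum>i<n. c i *\<^sub>C \<xi> i) (\<Sum>i<n. d i *\<^sub>C \<xi> i) = (\<Sum>i<n. c i * cnj (d i))" for n c d
    unfolding B_def
  proof (rule the_equality)
    show "R (\<Sum>i<n. c i *\<^sub>C \<xi> i) (\<Sum>i<n. d i *\<^sub>C \<xi> i) (\<Sum>i<n. c i * cnj (d i))" unfolding R_def by blast
    fix z assume "R (\<Sum>i<n. c i *\<^sub>C \<xi> i) (\<Sum>i<n. d i *\<^sub>C \<xi> i) z"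
    then obtain m c' d' where e: "(\<Sum>i<n. c i *\<^sub>C \<xi> i) = (\<Sum>i<m. c' i *\<^sub>C \<xi> i)"
      "(\<Sum>i<n. d i *\<^sub>C \<xi> i) = (\<Sum>i<m. d' i *\<^sub>C \<xi> i)" "z = (\<Sum>i<m. c' i * cnj (d' i))"
      unfolding R_def by blast
    have "pad n c i = pad m c' i" "pad n d i = pad m d' i" if "i < n + m" for i
      using e(1,2) pad[of n "n + m"] pad[of m "n + m"] uniq that by auto
    then show "z = (\<Sum>i<n. c i * cnj (d i))"
      unfolding e(3) using pad2[of n "n + m" c d] pad2[of m "n + m" c' d'] by simp
  qed
  have rep3: "\<exists>n a b c. x = (\<Sum>i<n. a i *\<^sub>C \<xi> i) \<and> y = (\<Sum>i<n. b i *\<^sub>C \<xi> i) \<and> z = (\<Sum>i<n. c i *\<^sub>C \<xi> i)"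
    if xyz: "x \<in> cspan_seq \<xi>" "y \<in> cspan_seq \<xi>" "z \<in> cspan_seq \<xi>" for x y z
  proof -
    obtain k a l b m c where "x = (\<Sum>i<k. a i *\<^sub>C \<xi> i)" "y = (\<Sum>i<l. b i *\<^sub>C \<xi> i)" "z = (\<Sum>i<m. c i *\<^sub>C \<xi> i)"
      using xyz unfolding cspan_seq_def by blast
    then show ?thesis
      using pad[of k "k + l + m" a] pad[of l "k + l + m" b] pad[of m "k + l + m" c]
      by (intro exI[of _ "k + l + m"] exI[of _ "pad k a"] exI[of _ "pad l b"] exI[of _ "pad m c"]) simp
  qed
  have "inner_on (cspan_seq \<xi>) B"
    unfolding inner_on_def
  proof (intro conjI ballI allI impI)
    fix x y z assume "x \<in> cspan_seq \<xi>" "y \<in> cspan_seq \<xi>" "z \<in> cspan_seq \<xi>"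
    then obtain n a b c where r: "x = (\<Sum>i<n. a i *\<^sub>C \<xi> i)" "y = (\<Sum>i<n. b i *\<^sub>C \<xi> i)" "z = (\<Sum>i<n. c i *\<^sub>C \<xi> i)"
      using rep3[of x y z] by blast
    have "x + y = (\<Sum>i<n. (a i + b i) *\<^sub>C \<xi> i)"
      by (simp add: r scaleC_add_left sum.distrib)
    then have "B (x + y) z = (\<Sum>i<n. (a i + b i) * cnj (c i))"
      by (simp only: r(3) B)
    then show "B (x + y) z = B x z + B y z"
      by (simp add: r B distrib_right sum.distrib)
  next
    fix k x y assume "x \<in> cspan_seq \<xi>" "y \<in> cspan_seq \<xi>"
    then obtain n a b where r: "x = (\<Sum>i<n. a i *\<^sub>C \<xi> i)" "y = (\<Sum>i<n. b i *\<^sub>C \<xi> i)"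
      using rep3[of x y y] by blast
    have "k *\<^sub>C x = (\<Sum>i<n. (k * a i) *\<^sub>C \<xi> i)"
      by (simp add: r cvec.scale_sum_right)
    then have "B (k *\<^sub>C x) y = (\<Sum>i<n. k * a i * cnj (b i))"
      by (simp only: r(2) B)
    then show "B (k *\<^sub>C x) y = k * B x y"
      by (simp add: r B sum_distrib_left mult.assoc)
  next
    fix x y assume "x \<in> cspan_seq \<xi>" "y \<in> cspan_seq \<xi>"
    then obtain n a b where r: "x = (\<Sum>i<n. a i *\<^sub>C \<xi> i)" "y = (\<Sum>i<n. b i *\<^sub>C \<xi> i)"
      using rep3[of x y y] by blast
    show "B y x = cnj (B x y)" by (simp add: r B mult.commute)
  next
    fix x assume "x \<in> cspan_seq \<xi>"
    then obtain n a where r: "x = (\<Sum>i<n. a i *\<^sub>C \<xi> i)" unfolding cspan_seq_def by blast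
    have Bx: "B x x = of_real (\<Sum>i<n. (cmod (a i))\<^sup>2)"
      by (simp add: r B flip: complex_norm_square)
    show "0 \<le> Re (B x x)" by (simp add: Bx sum_nonneg)
    show "x = 0" if "B x x = 0"
    proof -
      have "(\<Sum>i<n. (cmod (a i))\<^sup>2) = 0" using that Bx of_real_eq_0_iff by metis
      then have "\<forall>i<n. a i = 0" by (simp add: sum_nonneg_eq_0_iff)
      then show ?thesis by (simp add: r)
    qed
  qed
  from that[OF this B] show thesis .
qed

subsection \<open>Completeness and Schauder bases\<close>

text \<open>A norm-Cauchy sequence generates a Cauchy filter for \<open>P\<close>, since each member
  of \<open>P\<close> is continuous for the norm and hence bounded by a multiple of it. The limit of
  the filter is a norm limit because the topologies agree.\<close>

lemma sn_complete_imp_ip_complete: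
  fixes S :: "'a::cvector set"
  assumes S: "csubspace S" and P: "\<forall>p\<in>P. seminorm_on S p" and inner: "inner_on S ip"
    and top: "\<And>U. sn_open S {ipnorm ip} U \<longleftrightarrow> sn_open S P U" and complete: "sn_complete S P"
  shows "ip_complete S ip"
  unfolding ip_complete_def
proof (intro allI impI, elim conjE)
  interpret cinner S ip using S inner by unfold_locales
  fix s :: "nat \<Rightarrow> 'a" assume s: "\<forall>n. s n \<in> S" and Cauchy: "\<forall>e>0. \<exists>N. \<forall>m\<ge>N. \<forall>n\<ge>N. nm (s m - s n) < e"
  define F where "F = filtermap s sequentially"
  have "\<forall>\<^sub>F (x, y) in F \<times>\<^sub>F F. p (x - y) < e" if p: "p \<in> P" and e: "e > 0" for p e
  proof -
    have "cont_seminorm S {nm} p"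
      using member_cont_seminorm[OF S P p] cont_seminorm_cong[OF top] by blast
    then obtain C where C: "C > 0" "\<And>x. x \<in> S \<Longrightarrow> p x \<le> C * nm x" using cont_seminorm_bound by blast
    obtain N where N: "\<forall>m\<ge>N. \<forall>n\<ge>N. nm (s m - s n) < e / C" using Cauchy e C(1) by (meson divide_pos_pos)
    have "p (s m - s n) < e" if "m \<ge> N" "n \<ge> N" for m n
    proof -
      have "p (s m - s n) \<le> C * nm (s m - s n)" using C s by simp
      also have "\<dots> < e" using N that C(1) by (simp add: field_simps)
      finally show ?thesis .
    qed
    moreover have "\<forall>\<^sub>F x in F. \<exists>n\<ge>N. x = s n"
      unfolding F_def eventually_filtermap using eventually_ge_at_top[of N] by eventually_elim blast
    ultimately show ?thesis
      unfolding eventually_prod_filter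
      by (intro exI[of _ "\<lambda>x. \<exists>n\<ge>N. x = s n"] conjI) auto
  qed
  moreover have "F \<noteq> bot" "\<forall>\<^sub>F x in F. x \<in> S"
    using s by (simp_all add: F_def filtermap_bot_iff eventually_filtermap)
  ultimately obtain x where x: "x \<in> S" "\<forall>U. sn_open S P U \<and> x \<in> U \<longrightarrow> (\<forall>\<^sub>F y in F. y \<in> U)"
    using complete unfolding sn_complete_def by meson
  then have "sn_tendsto S P s x" by (simp add: sn_tendsto_def F_def eventually_filtermap)
  then have "sn_tendsto S {nm} s x" using sn_tendsto_cong[OF top] by blast
  then show "\<exists>x\<in>S. (\<lambda>n. nm (s n - x)) \<longlonglongrightarrow> 0" using tendsto_iff s by blast
qed

text \<open>The coefficient functionals are the inner products with the \<open>e n\<close>. Any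
  convergent expansion has these coefficients, because pairing its partial sums with
  \<open>e i\<close> gives a sequence that is eventually \<open>a i\<close>.\<close>

lemma (in hilbert_basis) schauder_basis: "schauder_basis S {nm} e"
  unfolding schauder_basis_def
proof (intro conjI exI allI ballI impI)
  show "cont_fun S {nm} (\<lambda>x. ip x (e n))" for n by (intro ip_cont_fun) auto
  show "sn_tendsto S {nm} (\<lambda>N. \<Sum>n<N. ip x (e n) *\<^sub>C e n) x" if "x \<in> S" for x
    using that expansion by (simp add: tendsto_iff)
  show "a = (\<lambda>n. ip x (e n))" if "x \<in> S" "sn_tendsto S {nm} (\<lambda>N. \<Sum>n<N. a n *\<^sub>C e n) x" for x a
  proof
    fix i
    have "(\<lambda>N. nm ((\<Sum>n<N. a n *\<^sub>C e n) - x)) \<longlonglongrightarrow> 0" using that by (simp add: tendsto_iff)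
    then have "(\<lambda>N. ip (\<Sum>n<N. a n *\<^sub>C e n) (e i)) \<longlonglongrightarrow> ip x (e i)"
      using that by (intro ip_tendsto_left) auto
    moreover have "\<forall>\<^sub>F N in sequentially. ip (\<Sum>n<N. a n *\<^sub>C e n) (e i) = a i"
      using eventually_gt_at_top[of i] by eventually_elim (simp add: ip_comb)
    then have "(\<lambda>N. ip (\<Sum>n<N. a n *\<^sub>C e n) (e i)) \<longlonglongrightarrow> a i" by (rule tendsto_eventually)
    ultimately show "a i = ip x (e i)" using LIMSEQ_unique by blast
  qed
qed simp

subsection \<open>Inner products for which a sequence is an orthonormal basis\<close>

text \<open>The requirements of (ii) on one inner product; (i) and (iii) are each compared with the
  existence of such a product.\<close>

definition orthonormalizing :: "'a::cvector set \<Rightarrow> ('a \<Rightarrow> real) set \<Rightarrow> (nat \<Rightarrow> 'a) \<Rightarrow> ('a \<Rightarrow> 'a \<Rightarrow> complex) \<Rightarrow> bool" where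
  "orthonormalizing D P \<xi> ip1 \<longleftrightarrow> inner_on D ip1 \<and> (\<forall>U. sn_open D {ipnorm ip1} U \<longleftrightarrow> sn_open D P U) \<and>
     ip_complete D ip1 \<and> onb_on D ip1 \<xi>"

text \<open>Statement (iii) in full.\<close>

definition riesz_bounds :: "'a::cvector set \<Rightarrow> ('a \<Rightarrow> real) set \<Rightarrow> (nat \<Rightarrow> 'a) \<Rightarrow> bool" where
  "riesz_bounds D P \<xi> \<longleftrightarrow> sn_dense D P (cspan_seq \<xi>) \<and>
     (\<exists>p. cont_seminorm D P p \<and> (\<forall>n c. (\<Sum>i<n. (cmod (c i))\<^sup>2) \<le> (p (\<Sum>i<n. c i *\<^sub>C \<xi> i))\<^sup>2)) \<and>
     (\<forall>q. cont_seminorm D P q \<longrightarrow>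
        (\<exists>C>0. \<forall>n c. (q (\<Sum>i<n. c i *\<^sub>C \<xi> i))\<^sup>2 \<le> C * (\<Sum>i<n. (cmod (c i))\<^sup>2)))"

section \<open>The implications between the three statements\<close>

text \<open>The pulled back product makes \<open>T\<close> an isometry of \<open>D\<close> onto
  \<open>H\<close>, so completeness and the orthonormal basis are carried back from
  \<open>H\<close>. Continuity of \<open>T\<close> and of its inverse say precisely that the new
  norm induces \<open>t\<close>.\<close>

lemma riesz_op_imp_orthonormalizing:
  fixes D :: "'a::cvector set"
  assumes D: "csubspace D" and H: "hilbert_on UNIV ip" and \<xi>: "\<And>n. \<xi> n \<in> D"
    and T: "riesz_op ip D P \<xi> T" "T ` D = UNIV" "sn_cont UNIV {ipnorm ip} D P (the_inv_into D T)"
  shows "orthonormalizing D P \<xi> (\<lambda>x y. ip (T x) (T y))"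
proof -
  define ip1 where "ip1 = (\<lambda>x y. ip (T x) (T y))"
  interpret complex_subspace D using D by unfold_locales
  interpret H: cinner UNIV ip using H by unfold_locales (auto simp: hilbert_on_def)
  have T': "clinear_on D T" "sn_cont D P UNIV {H.nm} T" "inj_on T D" "onb_on UNIV ip (\<lambda>n. T (\<xi> n))"
    using T(1) by (auto simp: riesz_op_def)
  have add: "T (x + y) = T x + T y" and sc: "T (c *\<^sub>C x) = c *\<^sub>C T x" if "x \<in> D" "y \<in> D" for x y c
    using T'(1) that by (auto simp: clinear_on_def)
  have T0: "T 0 = 0" using sc[of 0 0 0] by simp
  have sub: "T (x - y) = T x - T y" if "x \<in> D" "y \<in> D" for x y
    using add[of "x - y" y] that by (simp add: algebra_simps)
  have T0_imp: "x = 0" if "x \<in> D" "T x = 0" for x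
    using inj_onD[OF T'(3), of x 0] that T0 by simp
  have inner: "inner_on D ip1"
    unfolding inner_on_def ip1_def
    using add sc H.ip_add_left H.ip_scale_left H.ip_self_nonneg T0_imp H.ip_zero_imp
    by (simp, blast intro: H.ip_cnj)
  interpret cinner D ip1 using inner by unfold_locales
  have nm: "nm x = H.nm (T x)" for x by (simp add: ipnorm_def ip1_def)
  have lin: "clinear_on D T" by (rule T')
  have contT: "sn_cont D {nm} UNIV {H.nm} T"
    by (rule bounded_linear_sn_cont[OF D lin]) (simp_all add: nm)
  \<comment> \<open>Surjectivity enters here: every point of the ball about \<open>z\<close> in
    \<open>H\<close> is the image of a point of \<open>D\<close> at the same distance.\<close>
  have image_open: "sn_open UNIV {H.nm} (T ` U)" if U: "sn_open D {nm} U" for U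
    unfolding sn_open_single
  proof (intro conjI ballI)
    fix z assume "z \<in> T ` U"
    then obtain x where x: "x \<in> U" "z = T x" by blast
    then obtain d where d: "d > 0" "{y\<in>D. nm (y - x) < d} \<subseteq> U" "x \<in> D"
      using U unfolding sn_open_single by blast
    have "w \<in> T ` U" if w: "H.nm (w - z) < d" for w
    proof -
      obtain y where y: "y \<in> D" "w = T y" using T(2) by blast
      then have "y \<in> U" using d w x by (auto simp: nm sub)
      with y show ?thesis by blast
    qed
    with d show "\<exists>d>0. {y\<in>UNIV. H.nm (y - z) < d} \<subseteq> T ` U" by blast
  qed simp
  have pre_image: "{x\<in>D. T x \<in> T ` U} = U" if "U \<subseteq> D" for U
    using that T'(3) by (auto simp: inj_on_def)
  \<comment> \<open>Preimages under the inverse are images under \<open>T\<close>, which turns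
    continuity of the inverse into openness of \<open>T\<close>.\<close>
  have image_pre: "{y\<in>UNIV. the_inv_into D T y \<in> U} = T ` U" if U: "U \<subseteq> D" for U
  proof (rule set_eqI)
    fix y
    obtain x where x: "x \<in> D" "y = T x" using T(2) by blast
    then show "y \<in> {y\<in>UNIV. the_inv_into D T y \<in> U} \<longleftrightarrow> y \<in> T ` U"
      using inj_on_image_mem_iff[OF T'(3) x(1) U] the_inv_into_f_f[OF T'(3) x(1)] by simp
  qed
  have top: "sn_open D {nm} U \<longleftrightarrow> sn_open D P U" for U
  proof
    assume U: "sn_open D {nm} U"
    then have "U \<subseteq> D" by (simp add: sn_open_def)
    then show "sn_open D P U"
      using T'(2) image_open[OF U] pre_image unfolding sn_cont_def by metis
  next
    assume U: "sn_open D P U"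
    then have UD: "U \<subseteq> D" by (simp add: sn_open_def)
    have "sn_open UNIV {H.nm} (T ` U)"
      using T(3) U image_pre[OF UD] unfolding sn_cont_def by metis
    then show "sn_open D {nm} U"
      using contT pre_image[OF UD] unfolding sn_cont_def by metis
  qed
  have complete: "ip_complete D ip1"
    unfolding ip_complete_def
  proof (intro allI impI, elim conjE)
    fix s :: "nat \<Rightarrow> 'a" assume s: "\<forall>n. s n \<in> D" and C: "\<forall>e>0. \<exists>N. \<forall>m\<ge>N. \<forall>n\<ge>N. nm (s m - s n) < e"
    have "\<forall>e>0. \<exists>N. \<forall>m\<ge>N. \<forall>n\<ge>N. H.nm (T (s m) - T (s n)) < e"
      using C s by (simp add: nm sub)
    then obtain z where z: "(\<lambda>n. H.nm (T (s n) - z)) \<longlonglongrightarrow> 0"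
      using H[unfolded hilbert_on_def ip_complete_def, THEN conjunct2, THEN conjunct2, rule_format, of "\<lambda>n. T (s n)"]
      by auto
    obtain x where x: "x \<in> D" "z = T x" using T(2) by blast
    then show "\<exists>x\<in>D. (\<lambda>n. nm (s n - x)) \<longlonglongrightarrow> 0"
      using z s by (intro bexI[of _ x]) (simp_all add: nm sub)
  qed
  have T_sum: "T (\<Sum>i<n. c i *\<^sub>C \<xi> i) = (\<Sum>i<n. c i *\<^sub>C T (\<xi> i))" for n c
  proof (induction n)
    case (Suc n)
    have "(\<Sum>i<n. c i *\<^sub>C \<xi> i) \<in> D" using \<xi> by (intro sum_mem mem)
    with Suc show ?case using \<xi> by (simp add: add sc)
  qed (simp add: T0)
  \<comment> \<open>The image of a nonempty open set is open in \<open>H\<close> and so meets the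
    span of the \<open>T (\<xi> n)\<close>; injectivity brings the common point back to the span of
    \<open>\<xi>\<close>.\<close>
  have "sn_dense D {nm} (cspan_seq \<xi>)"
    unfolding sn_dense_def
  proof (intro conjI allI impI)
    show "cspan_seq \<xi> \<subseteq> D" using \<xi> by (auto simp: cspan_seq_def)
    fix U assume U: "sn_open D {nm} U \<and> U \<noteq> {}"
    then have "T ` U \<inter> cspan_seq (\<lambda>n. T (\<xi> n)) \<noteq> {}"
      using image_open T'(4) unfolding onb_on_def sn_dense_def by blast
    then obtain x n c where x: "x \<in> U" "T x = T (\<Sum>i<n. c i *\<^sub>C \<xi> i)"
      unfolding cspan_seq_def T_sum by blast
    moreover have "x \<in> D" using U x(1) by (auto simp: sn_open_def)
    moreover have "(\<Sum>i<n. c i *\<^sub>C \<xi> i) \<in> D" using \<xi> by (intro sum_mem mem)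
    ultimately have "x = (\<Sum>i<n. c i *\<^sub>C \<xi> i)" using inj_onD[OF T'(3)] by blast
    with x show "U \<inter> cspan_seq \<xi> \<noteq> {}" unfolding cspan_seq_def by blast
  qed
  moreover have "ip1 (\<xi> i) (\<xi> j) = (if i = j then 1 else 0)" for i j
    using T'(4) by (simp add: onb_on_def ip1_def)
  ultimately have "onb_on D ip1 \<xi>" using \<xi> by (simp add: onb_on_def)
  with inner top complete show ?thesis by (simp add: orthonormalizing_def ip1_def)
qed

text \<open>An isometry from \<open>D\<close> with \<open>ip1\<close> onto \<open>H\<close> is a
  homeomorphism for the norms, and on \<open>D\<close> the norm topology is \<open>t\<close>. The
  Schauder property likewise passes from the norm to \<open>P\<close>.\<close>

lemma orthonormalizing_imp_riesz_op:
  assumes rhs: "rigged ip D P" and ip1: "orthonormalizing D P \<xi> ip1"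
  shows "riesz_like ip D P \<xi>"
    and "\<exists>T. riesz_op ip D P \<xi> T \<and> T ` D = UNIV \<and> sn_cont UNIV {ipnorm ip} D P (the_inv_into D T)"
proof -
  have D: "csubspace D" and H: "hilbert_on UNIV ip" and densD: "sn_dense UNIV {ipnorm ip} D"
    and finer: "\<And>U. sn_open D {ipnorm ip} U \<Longrightarrow> sn_open D P U"
    using rhs by (auto simp: rigged_def)
  have top: "\<And>U. sn_open D {ipnorm ip1} U \<longleftrightarrow> sn_open D P U"
    using ip1 by (simp add: orthonormalizing_def)
  interpret hilbert_basis D ip1 \<xi>
    using D ip1 by (intro hilbert_basisI) (auto simp: orthonormalizing_def)
  interpret H: cinner UNIV ip using H by unfold_locales (auto simp: hilbert_on_def)
  \<comment> \<open>With respect to \<open>ip1\<close>, \<open>\<xi> n\<close> is orthogonal to its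
    predecessors but not to itself. Independence does not refer to a product, so it can be used with
    \<open>ip\<close>.\<close>
  have indep: "\<xi> n \<notin> cvec.span (\<xi> ` {..<n})" for n
  proof
    assume n: "\<xi> n \<in> cvec.span (\<xi> ` {..<n})"
    have "cvec.subspace {x\<in>D. ip1 x (\<xi> n) = 0}"
      by (simp add: cvec.subspace_def ip_add_left ip_scale_left mem)
    moreover have "\<xi> ` {..<n} \<subseteq> {x\<in>D. ip1 x (\<xi> n) = 0}" by (auto simp: ortho)
    ultimately have "cvec.span (\<xi> ` {..<n}) \<subseteq> {x\<in>D. ip1 x (\<xi> n) = 0}" by (intro cvec.span_minimal)
    with n show False by (auto simp: ortho)
  qed
  define e where "e = gram_schmidt ip \<xi>"
  interpret e: orthonormal_seq UNIV ip e
    unfolding e_def by (rule H.gram_schmidt_orthonormal) (use indep in auto)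
  have span: "cspan_seq \<xi> \<subseteq> cspan_seq e"
    unfolding e_def cspan_seq_eq_span by (rule H.gram_schmidt_orthonormal) (use indep in auto)
  \<comment> \<open>An open set of \<open>H\<close> meets \<open>D\<close>, its trace on
    \<open>D\<close> is \<open>t\<close>-open because \<open>t\<close> is finer, and the span of
    \<open>\<xi>\<close> is \<open>t\<close>-dense.\<close>
  have "sn_dense UNIV {H.nm} (cspan_seq e)"
    unfolding sn_dense_def
  proof (intro conjI allI impI)
    fix U assume U: "sn_open UNIV {H.nm} U \<and> U \<noteq> {}"
    then have "U \<inter> D \<noteq> {}" using densD by (simp add: sn_dense_def)
    moreover have "sn_open D {H.nm} (U \<inter> D)"
      unfolding sn_open_single
    proof (intro conjI ballI)
      fix x assume "x \<in> U \<inter> D"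
      then obtain d where "d > 0" "{y\<in>UNIV. H.nm (y - x) < d} \<subseteq> U"
        using U unfolding sn_open_single by blast
      then show "\<exists>d>0. {y\<in>D. H.nm (y - x) < d} \<subseteq> U \<inter> D" by (intro exI[of _ d]) auto
    qed simp
    ultimately have "(U \<inter> D) \<inter> cspan_seq \<xi> \<noteq> {}"
      using dense finer top unfolding sn_dense_def by blast
    with span show "U \<inter> cspan_seq e \<noteq> {}" by blast
  qed simp
  then have "hilbert_basis UNIV ip e"
    using H e.ortho by (intro hilbert_basisI) (auto simp: hilbert_on_def onb_on_def)
  then obtain T where T: "clinear_on D T" "bij_betw T D UNIV" "\<And>x. x \<in> D \<Longrightarrow> H.nm (T x) = nm x"
    "\<And>n. T (\<xi> n) = e n"
    using onb_isometry[OF hilbert_basis_axioms] by metis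
  have inj: "inj_on T D" and surj: "T ` D = UNIV" using T(2) by (auto simp: bij_betw_def)
  have "sn_cont D {nm} UNIV {H.nm} T"
    by (rule bounded_linear_sn_cont[OF D T(1)]) (simp_all add: T(3))
  then have contT: "sn_cont D P UNIV {H.nm} T" using sn_cont_cong[OF top refl] by blast
  have R: "riesz_op ip D P \<xi> T"
    unfolding riesz_op_def T(4) using T(1) contT inj \<open>hilbert_basis UNIV ip e\<close>
    by (auto simp: onb_on_def e.ortho hilbert_basis_def orthonormal_basis_def orthonormal_basis_axioms_def)
  define T' where "T' = the_inv_into D T"
  have T'D: "T' y \<in> D" and TT': "T (T' y) = y" for y
    using f_the_inv_into_f[OF inj] the_inv_into_into[OF inj _ subset_refl] surj by (auto simp: T'_def)
  have T'_eq: "T' y = x" if "x \<in> D" "T x = y" for x y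
    using the_inv_into_f_f[OF inj that(1)] that(2) by (simp add: T'_def)
  have "clinear_on UNIV T'"
    unfolding clinear_on_def
    using T(1) T'D TT' by (auto intro!: T'_eq simp: clinear_on_def)
  then have "sn_cont UNIV {H.nm} D {nm} T'"
    by (rule bounded_linear_sn_cont[OF H.subspace]) (use T(3) T'D TT' in \<open>auto simp flip: T(3)\<close>)
  then have "sn_cont UNIV {H.nm} D P T'" using sn_cont_cong[OF refl top] by blast
  with R surj show "\<exists>T. riesz_op ip D P \<xi> T \<and> T ` D = UNIV \<and> sn_cont UNIV {ipnorm ip} D P (the_inv_into D T)"
    unfolding T'_def by blast
  have "schauder_basis D P \<xi>"
    using schauder_basis unfolding schauder_basis_def cont_fun_cong[OF top] sn_tendsto_cong[OF top] .
  with R show "riesz_like ip D P \<xi>" by (auto simp: riesz_like_def)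
qed

text \<open>For the Hilbert norm the lower bound is an equality. If \<open>q\<close> is at most
  \<open>C\<close> times this norm, then \<open>C\<^sup>2\<close> is the constant of the upper
  bound.\<close>

lemma orthonormalizing_imp_riesz_bounds:
  assumes D: "csubspace D" and ip1: "orthonormalizing D P \<xi> ip1"
  shows "riesz_bounds D P \<xi>"
proof -
  have top: "\<And>U. sn_open D {ipnorm ip1} U \<longleftrightarrow> sn_open D P U"
    using ip1 by (simp add: orthonormalizing_def)
  interpret hilbert_basis D ip1 \<xi>
    using D ip1 by (intro hilbert_basisI) (auto simp: orthonormalizing_def)
  have "\<exists>C>0. \<forall>n c. (q (\<Sum>i<n. c i *\<^sub>C \<xi> i))\<^sup>2 \<le> C * (\<Sum>i<n. (cmod (c i))\<^sup>2)" if q: "cont_seminorm D P q" for q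
  proof -
    have q': "cont_seminorm D {nm} q" using q cont_seminorm_cong[OF top] by blast
    then obtain C where C: "C > 0" "\<And>x. x \<in> D \<Longrightarrow> q x \<le> C * nm x" using cont_seminorm_bound by blast
    have "(q (\<Sum>i<n. c i *\<^sub>C \<xi> i))\<^sup>2 \<le> C\<^sup>2 * (\<Sum>i<n. (cmod (c i))\<^sup>2)" for n c
    proof -
      have "0 \<le> q (\<Sum>i<n. c i *\<^sub>C \<xi> i)" using q comb_mem by (auto simp: cont_seminorm_def seminorm_on_def)
      then have "(q (\<Sum>i<n. c i *\<^sub>C \<xi> i))\<^sup>2 \<le> (C * nm (\<Sum>i<n. c i *\<^sub>C \<xi> i))\<^sup>2"
        using C(2) comb_mem by (intro power_mono) auto
      then show ?thesis by (simp add: power_mult_distrib nm_comb)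
    qed
    with C(1) show ?thesis by (intro exI[of _ "C\<^sup>2"]) simp
  qed
  moreover have "cont_seminorm D P nm" using cont_seminorm_self cont_seminorm_cong[OF top] by blast
  moreover have "sn_dense D P (cspan_seq \<xi>)" using dense sn_dense_cong[OF top] by blast
  ultimately show ?thesis
    unfolding riesz_bounds_def by (intro conjI exI[of _ nm]) (auto simp: nm_comb)
qed

text \<open>The pivot is \<open>dom\<close>: every continuous seminorm is at most a multiple of
  \<open>p\<close>. It yields definiteness of \<open>p\<close> and the comparison of
  topologies.\<close>

lemma riesz_bounds_imp_orthonormalizing:
  assumes rhs: "rigged ip D P" and complete: "sn_complete D P" and \<xi>: "\<And>n. \<xi> n \<in> D"
    and bounds: "riesz_bounds D P \<xi>"
  shows "\<exists>ip1. orthonormalizing D P \<xi> ip1"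
proof -
  have D: "csubspace D" and H: "hilbert_on UNIV ip" and P: "\<forall>p\<in>P. seminorm_on D p"
    and finer: "\<And>U. sn_open D {ipnorm ip} U \<Longrightarrow> sn_open D P U"
    using rhs by (auto simp: rigged_def)
  obtain p where p: "cont_seminorm D P p"
    and low: "\<And>n c. (\<Sum>i<n. (cmod (c i))\<^sup>2) \<le> (p (\<Sum>i<n. c i *\<^sub>C \<xi> i))\<^sup>2"
    using bounds unfolding riesz_bounds_def by blast
  have up: "\<exists>C>0. \<forall>n c. (q (\<Sum>i<n. c i *\<^sub>C \<xi> i))\<^sup>2 \<le> C * (\<Sum>i<n. (cmod (c i))\<^sup>2)"
    if "cont_seminorm D P q" for q
    using bounds that unfolding riesz_bounds_def by blast
  have dens: "sn_dense D P (cspan_seq \<xi>)" using bounds by (simp add: riesz_bounds_def)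
  interpret seminormed D p using D p by unfold_locales (auto simp: cont_seminorm_def)
  interpret H: cinner UNIV ip using H by unfold_locales (auto simp: hilbert_on_def)
  have comb: "(\<Sum>i<n. c i *\<^sub>C \<xi> i) \<in> D" for n c using \<xi> by (intro sum_mem mem)
  then have ED: "cspan_seq \<xi> \<subseteq> D" by (auto simp: cspan_seq_def)
  \<comment> \<open>One element of the span must be close for \<open>p\<close> and \<open>q\<close>
    at once: away from the span nothing yet relates the two seminorms.\<close>
  have approx: "\<exists>u\<in>cspan_seq \<xi>. p (u - x) < d \<and> q (u - x) < d"
    if "x \<in> D" "d > 0" "cont_seminorm D P q" for x d q
  proof -
    interpret q: seminormed D q using D that by unfold_locales (auto simp: cont_seminorm_def)
    let ?U = "{y\<in>D. p (y - x) < d} \<inter> {y\<in>D. q (y - x) < d}"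
    have "sn_open D P ?U"
      using cont_seminorm_ball_open[OF D] p that by (intro sn_open_Int) auto
    moreover have "x \<in> ?U" using that by simp
    ultimately have "?U \<inter> cspan_seq \<xi> \<noteq> {}" using dens unfolding sn_dense_def by blast
    then show ?thesis by blast
  qed
  have dom: "\<exists>K>0. \<forall>x\<in>D. q x \<le> K * p x" if q: "cont_seminorm D P q" for q
  proof -
    interpret q: seminormed D q using D q by unfold_locales (auto simp: cont_seminorm_def)
    obtain C where C: "C > 0" "\<And>n c. (q (\<Sum>i<n. c i *\<^sub>C \<xi> i))\<^sup>2 \<le> C * (\<Sum>i<n. (cmod (c i))\<^sup>2)"
      using up[OF q] by blast
    define K where "K = sqrt C"
    have K: "K > 0" "C = K\<^sup>2" using C(1) by (simp_all add: K_def)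
    have on_span: "q u \<le> K * p u" if u: "u \<in> cspan_seq \<xi>" for u
    proof (rule power2_le_imp_le)
      obtain n c where u': "u = (\<Sum>i<n. c i *\<^sub>C \<xi> i)" using u unfolding cspan_seq_def by blast
      have "(q u)\<^sup>2 \<le> C * (p u)\<^sup>2"
        unfolding u' using C(1) by (intro order_trans[OF C(2)] mult_left_mono low) simp
      then show "(q u)\<^sup>2 \<le> (K * p u)\<^sup>2" by (simp add: power_mult_distrib K)
    qed (use K u ED in auto)
    have "q x \<le> K * p x" if x: "x \<in> D" for x
    proof (rule field_le_epsilon)
      fix d :: real assume d: "d > 0"
      \<comment> \<open>The error of the approximation enters once directly through
        \<open>q (u - x)\<close> and once multiplied by \<open>K\<close> through \<open>p u\<close>,
        in total \<open>r * (1 + K)\<close>.\<close>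
      define r where "r = d / (1 + K)"
      have r: "r > 0" using d K by (simp add: r_def)
      obtain u where u: "u \<in> cspan_seq \<xi>" "p (u - x) < r" "q (u - x) < r" using approx[OF x r q] by blast
      have uD: "u \<in> D" using u ED by blast
      have "q x \<le> q (u - x) + q u"
        using q.triangle_diff[of u "u - x"] uD x by simp
      also have "\<dots> \<le> r + K * (p x + r)"
      proof -
        have "p u \<le> p x + r" using abs_diff[OF uD x] u by simp
        then have "K * p u \<le> K * (p x + r)" using K by simp
        then show ?thesis using on_span[OF u(1)] u(3) by simp
      qed
      also have "\<dots> = K * p x + r * (1 + K)" by (simp add: algebra_simps)
      also have "r * (1 + K) = d" using K by (simp add: r_def)
      finally show "q x \<le> K * p x + d" .
    qed
    with K show ?thesis by blast
  qed
  \<comment> \<open>The norm of \<open>H\<close>, restricted to \<open>D\<close>, is a continuous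
    seminorm because \<open>t\<close> is finer, so \<open>dom\<close> bounds it by a multiple of
    \<open>p\<close>.\<close>
  have definite: "x = 0" if x: "x \<in> D" "p x = 0" for x
  proof -
    have "inner_on D ip" unfolding inner_on_def
      by (intro conjI ballI allI impI;
          rule H.ip_add_left H.ip_scale_left H.ip_cnj H.ip_self_nonneg H.ip_zero_imp; simp)
    then interpret HD: cinner D ip using D by unfold_locales
    have "cont_seminorm D P H.nm"
      using HD.cont_seminorm_self finer unfolding cont_seminorm_def cont_fun_def by blast
    then obtain K where "\<forall>x\<in>D. H.nm x \<le> K * p x" using dom by blast
    then have "H.nm x \<le> 0" using x by force
    then show ?thesis using HD.nm_eq_0_imp[OF x(1) antisym] HD.nonneg[OF x(1)] by blast
  qed
  have indep: "\<forall>i<n. c i = 0" if "(\<Sum>i<n. c i *\<^sub>C \<xi> i) = 0" for n c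
  proof -
    have "(\<Sum>i<n. (cmod (c i))\<^sup>2) \<le> 0" using low[of c n] that by simp
    then have "(\<Sum>i<n. (cmod (c i))\<^sup>2) = 0" by (meson antisym sum_nonneg zero_le_power2)
    then show ?thesis by (simp add: sum_nonneg_eq_0_iff)
  qed
  obtain B where B: "inner_on (cspan_seq \<xi>) B"
    "\<And>n c d. B (\<Sum>i<n. c i *\<^sub>C \<xi> i) (\<Sum>i<n. d i *\<^sub>C \<xi> i) = (\<Sum>i<n. c i * cnj (d i))"
    using coefficient_inner_product[of \<xi>] indep by metis
  have nB: "(ipnorm B (\<Sum>i<n. c i *\<^sub>C \<xi> i))\<^sup>2 = (\<Sum>i<n. (cmod (c i))\<^sup>2)" for n c
    by (simp add: ipnorm_def B(2) sum_nonneg flip: complex_norm_square)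
  obtain C where C: "C > 0" "\<And>n c. (p (\<Sum>i<n. c i *\<^sub>C \<xi> i))\<^sup>2 \<le> C * (\<Sum>i<n. (cmod (c i))\<^sup>2)"
    using up[OF p] by blast
  interpret E: cinner "cspan_seq \<xi>" B
    using B by unfold_locales (auto simp: csubspace_cspan_seq)
  have le: "E.nm u \<le> p u" and ge: "p u \<le> sqrt C * E.nm u" if u: "u \<in> cspan_seq \<xi>" for u
  proof -
    obtain n c where u': "u = (\<Sum>i<n. c i *\<^sub>C \<xi> i)" using u unfolding cspan_seq_def by blast
    show "E.nm u \<le> p u"
      by (rule power2_le_imp_le) (use low[of c n] nB[of c n] u u' ED in auto)
    show "p u \<le> sqrt C * E.nm u"
      by (rule power2_le_imp_le) (use C(1) C(2)[of c n] nB[of c n] u u' in \<open>auto simp: power_mult_distrib\<close>)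
  qed
  \<comment> \<open>The constant \<open>sqrt C\<close> comes from the upper bound taken with
    \<open>q = p\<close>: on the span, \<open>p\<close> lies between the coefficient norm and
    \<open>sqrt C\<close> times that norm.\<close>
  obtain ip1 where ip1: "inner_on D ip1" "\<And>u v. u \<in> cspan_seq \<xi> \<Longrightarrow> v \<in> cspan_seq \<xi> \<Longrightarrow> ip1 u v = B u v"
    "\<And>x. x \<in> D \<Longrightarrow> ipnorm ip1 x \<le> p x" "\<And>x. x \<in> D \<Longrightarrow> p x \<le> sqrt C * ipnorm ip1 x"
    by (rule inner_product_extension[OF csubspace_cspan_seq ED _ B(1) le ge definite]) (use approx p in blast)+
  interpret I: cinner D ip1 using ip1 by unfold_locales
  have top: "sn_open D {I.nm} U \<longleftrightarrow> sn_open D P U" for U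
  proof (rule sn_open_iff_dominating_norm[OF D P I.seminorm p ip1(3)])
    fix q assume "q \<in> P"
    then obtain K where K: "K > 0" "\<And>x. x \<in> D \<Longrightarrow> q x \<le> K * p x" using dom member_cont_seminorm[OF D P] by blast
    have "q x \<le> (K * sqrt C) * I.nm x" if "x \<in> D" for x
      using order_trans[OF K(2)[OF that] mult_left_mono[OF ip1(4)[OF that], of K]] K(1) by (simp add: mult.assoc)
    then show "\<exists>C>0. \<forall>x\<in>D. q x \<le> C * I.nm x"
      using K(1) C(1) by (intro exI[of _ "K * sqrt C"]) simp
  qed
  have "ip1 (\<xi> i) (\<xi> j) = (if i = j then 1 else 0)" for i j
  proof -
    \<comment> \<open>The formula for \<open>B\<close> requires both arguments as sums of the same
      length; \<open>Suc (i + j)\<close> accommodates \<open>\<xi> i\<close> and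
      \<open>\<xi> j\<close> together.\<close>
    have unit: "\<xi> k = (\<Sum>l<Suc (i + j). (if l = k then 1 else 0) *\<^sub>C \<xi> l)" if "k \<le> i + j" for k
    proof -
      have "(\<Sum>l<Suc (i + j). (if l = k then 1 else 0) *\<^sub>C \<xi> l) = (\<Sum>l<Suc (i + j). if l = k then \<xi> l else 0)"
        by (intro sum.cong) auto
      then show ?thesis using that by simp
    qed
    have "ip1 (\<xi> i) (\<xi> j) = B (\<xi> i) (\<xi> j)" using ip1(2) cspan_seq_base by blast
    also have "\<dots> = (\<Sum>l<Suc (i + j). (if l = i then 1 else 0) * cnj (if l = j then 1 else 0))"
      using B(2)[of "\<lambda>l. if l = i then 1 else 0" "Suc (i + j)" "\<lambda>l. if l = j then 1 else 0"]
        unit[of i] unit[of j] by simp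
    also have "\<dots> = (\<Sum>l<Suc (i + j). if l = i then (if i = j then 1 else 0) else 0)"
      by (intro sum.cong) auto
    finally show ?thesis by simp
  qed
  moreover have "sn_dense D {I.nm} (cspan_seq \<xi>)" using dens sn_dense_cong[OF top] by blast
  ultimately have "onb_on D ip1 \<xi>" using \<xi> by (simp add: onb_on_def)
  with ip1(1) top sn_complete_imp_ip_complete[OF D P ip1(1) top complete] show ?thesis
    by (auto simp: orthonormalizing_def)
qed

theorem theorem3p9:
  fixes ip :: "'a::cvector \<Rightarrow> 'a \<Rightarrow> complex"
    and D :: "'a set" and P :: "('a \<Rightarrow> real) set" and \<xi> :: "nat \<Rightarrow> 'a"
  assumes rhs: "rigged ip D P"
    and compl: "sn_complete D P"
    and refl: "sn_reflexive D P"
    and xi: "\<forall>n. \<xi> n \<in> D"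
  shows "((riesz_like ip D P \<xi> \<and>
           (\<exists>T. riesz_op ip D P \<xi> T \<and> T ` D = UNIV \<and>
                sn_cont UNIV {ipnorm ip} D P (the_inv_into D T)))
          \<longleftrightarrow>
          (\<exists>ip1. inner_on D ip1 \<and> (\<forall>U. sn_open D {ipnorm ip1} U \<longleftrightarrow> sn_open D P U) \<and>
                 ip_complete D ip1 \<and> onb_on D ip1 \<xi>))
       \<and>
         ((\<exists>ip1. inner_on D ip1 \<and> (\<forall>U. sn_open D {ipnorm ip1} U \<longleftrightarrow> sn_open D P U) \<and>
                 ip_complete D ip1 \<and> onb_on D ip1 \<xi>)
          \<longleftrightarrow>
          (sn_dense D P (cspan_seq \<xi>) \<and>
           (\<exists>p. cont_seminorm D P p \<and>
              (\<forall>n c. (\<Sum>i<n. (cmod (c i))\<^sup>2) \<le> (p (\<Sum>i<n. c i *\<^sub>C \<xi> i))\<^sup>2)) \<and>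
           (\<forall>q. cont_seminorm D P q \<longrightarrow>
              (\<exists>C>0. \<forall>n c. (q (\<Sum>i<n. c i *\<^sub>C \<xi> i))\<^sup>2 \<le> C * (\<Sum>i<n. (cmod (c i))\<^sup>2)))))"
  unfolding orthonormalizing_def[symmetric] riesz_bounds_def[symmetric]
proof -
  have D: "csubspace D" and H: "hilbert_on UNIV ip" using rhs by (auto simp: rigged_def)
  have "(riesz_like ip D P \<xi> \<and>
      (\<exists>T. riesz_op ip D P \<xi> T \<and> T ` D = UNIV \<and> sn_cont UNIV {ipnorm ip} D P (the_inv_into D T)))
    \<longleftrightarrow> (\<exists>ip1. orthonormalizing D P \<xi> ip1)"
    using riesz_op_imp_orthonormalizing[OF D H, of \<xi> P] xi orthonormalizing_imp_riesz_op[OF rhs] by blast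
  moreover have "(\<exists>ip1. orthonormalizing D P \<xi> ip1) \<longleftrightarrow> riesz_bounds D P \<xi>"
    using orthonormalizing_imp_riesz_bounds[OF D]
      riesz_bounds_imp_orthonormalizing[OF rhs compl, of \<xi>] xi by blast
  ultimately show "((riesz_like ip D P \<xi> \<and>
      (\<exists>T. riesz_op ip D P \<xi> T \<and> T ` D = UNIV \<and> sn_cont UNIV {ipnorm ip} D P (the_inv_into D T)))
    \<longleftrightarrow> (\<exists>ip1. orthonormalizing D P \<xi> ip1)) \<and> ((\<exists>ip1. orthonormalizing D P \<xi> ip1) \<longleftrightarrow> riesz_bounds D P \<xi>)"
    by blast
qed

end
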